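(* Let $K$ be a field of characteristic zero. For every basic subset $D\subset\Delta^+$, the basic cone $V_D$ coincides with the cone $\mathcal Y_{w_D}$ (as subsets of $\mathfrak n_-$). The basic cones are the tangent cones at the origin $p$ of the Schubert varieties $\mathcal X_w$ of the homogeneous elements $w$ of the Weyl group $W=S_n$ (under the identification $\mathcal O\cong\mathfrak n_-$ given by $\Psi$).
   Context: Roots. Fix $n\ge 1$. A positive root is a pair $(i,j)$ with $n\ge i>j\ge 1$; $\Delta^+$ is the set of positive roots; $i$ is its row and $j$ its column. For positive roots, $\gamma=\alpha+\beta$ means $\gamma=(i,k)$ and $\{\alpha,\beta\}=\{(i,j),(j,k)\}$ for some $i>j>k$. A subset $D\subset\Delta^+$ is basic if every row and every column contains at most one root of $D$. A positive root $\alpha$ is $D$-singular if there is a positive root $\beta$ with $\alpha+\beta\in D$; $S(D)$ is the set of $D$-singular roots, $R(D)=\Delta^+\setminus S(D)$, and $M(D)=R(D)\setminus D$. The permutation $w_D$. $w_D\in S_n$ is defined recursively: for $j=1,\dots,n$, $w_D(j)$ is the greatest $i\in\{1,\dots,n\}$ such that $(i,j)\notin M(D)$ and $i\notin\{w_D(1),\dots,w_D(j-1)\}$. Basic cones. $N=\mathrm{UT}(n,K)$ is the group of upper unitriangular $n\times n$ matrices, $\mathfrak n$ the Lie algebra of strictly upper triangular matrices, $\mathfrak n_-$ the space of strictly lower triangular matrices, identified with $\mathfrak n^*$ through the form $(A,B)=\mathrm{Tr}\,AB$. The left-right action of $(g,h)\in N\times N$ on $\mathfrak n^*=\mathfrak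 n_-$ sends $X$ to the strictly lower triangular part of $gXh^{-1}$. For a basic subset $D$ and a map $\varphi:D\to K^*$ put $X_{D,\varphi}=\sum_{\xi\in D}\varphi(\xi)E_\xi$, where $E_{(i,j)}$ is the matrix unit. The basic variety $V_{D,\varphi}$ is the $N\times N$-orbit of $X_{D,\varphi}$; the basic cell is $V_D^\circ=\bigsqcup_{\varphi}V_{D,\varphi}$, the union over all $\varphi:D\to K^*$; the basic cone $V_D$ is the Zariski closure of $V_D^\circ$ in $\mathfrak n_-$. Schubert varieties. Let $G=\mathrm{GL}(n,K)$, $B$ the subgroup of upper triangular matrices, $N_-$ the group of lower unitriangular matrices, $\mathcal X=G/B$ the flag variety, $p=B\bmod B$. The main affine neighborhood of $p$ is $\mathcal O=N_-B\bmod B$; the isomorphism of affine varieties $\Psi:\mathcal O\to\mathfrak n_-$ is defined by $g=(1+\Psi(g))\bmod B$ for $g\in\mathcal O$, and sends $p$ to $0$. For $w\in W=S_n$ let $\dot w$ be the permutation matrix with ones at the places $(w(j),j)$; the Schubert cell is $\mathcal X_w^\circ=B\dot wB\bmod B$ and the Schubert variety $\mathcal X_w$ is its Zariski closure. Put $\mathcal Y_w=\Psi(\mathcal X_w\cap\mathcal O)\subset\mathfrak n_-$. An element $w\in W$ is called homogeneous if $\mathcal Y_w$ is a cone with center at the origin of $\mathfrak n_-$. *)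

theory Defs
  imports
    "HOL-Library.Poly_Mapping"
    "HOL-Combinatorics.Permutations"
    "Jordan_Normal_Form.Gauss_Jordan_Elimination"
begin

text \<open>
  Matrices over a field are those of Jordan_Normal_Form, whose rows and columns are numbered
  from 0.  All indices (roots, permutations, matrix places) are therefore taken from
  \<open>{..<n}\<close> instead of \<open>{1..n}\<close>, via the order isomorphism \<open>i \<mapsto> i - 1\<close>.
  In particular \<open>S_n\<close> is the set of all \<open>w\<close> with \<open>w permutes {..<n}\<close>.
\<close>

section \<open>Roots and basic subsets\<close>

definition pos_roots :: "nat \<Rightarrow> (nat \<times> nat) set" where
  "pos_roots n = {(i, j). j < i \<and> i < n}"

text \<open>\<open>root_sum \<alpha> \<beta> \<gamma>\<close> is the relation \<open>\<gamma> = \<alpha> + \<beta>\<close>.\<close>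

definition root_sum :: "nat \<times> nat \<Rightarrow> nat \<times> nat \<Rightarrow> nat \<times> nat \<Rightarrow> bool" where
  "root_sum \<alpha> \<beta> \<gamma> \<longleftrightarrow>
     (\<exists>i j k. i > j \<and> j > k \<and> \<gamma> = (i, k) \<and> {\<alpha>, \<beta>} = {(i, j), (j, k)})"

definition basic_subset :: "nat \<Rightarrow> (nat \<times> nat) set \<Rightarrow> bool" where
  "basic_subset n D \<longleftrightarrow> D \<subseteq> pos_roots n \<and>
     (\<forall>\<alpha>\<in>D. \<forall>\<beta>\<in>D. fst \<alpha> = fst \<beta> \<or> snd \<alpha> = snd \<beta> \<longrightarrow> \<alpha> = \<beta>)"

definition singular_roots :: "nat \<Rightarrow> (nat \<times> nat) set \<Rightarrow> (nat \<times> nat) set" where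
  "singular_roots n D =
     {\<alpha> \<in> pos_roots n. \<exists>\<beta>\<in>pos_roots n. \<exists>\<gamma>\<in>D. root_sum \<alpha> \<beta> \<gamma>}"

definition regular_roots :: "nat \<Rightarrow> (nat \<times> nat) set \<Rightarrow> (nat \<times> nat) set" where
  "regular_roots n D = pos_roots n - singular_roots n D"

definition M_roots :: "nat \<Rightarrow> (nat \<times> nat) set \<Rightarrow> (nat \<times> nat) set" where
  "M_roots n D = regular_roots n D - D"

text \<open>
  The set under \<open>Max\<close> is nonempty: \<open>M_roots n D\<close> contains no \<open>(i, j)\<close> with \<open>i \<le> j\<close>, and
  the \<open>j\<close> values chosen earlier cannot exhaust the \<open>j + 1\<close> rows \<open>i \<le> j\<close>.
\<close>

fun basic_perm :: "nat \<Rightarrow> (nat \<times> nat) set \<Rightarrow> nat \<Rightarrow> nat" where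
  "basic_perm n D j =
     (if j < n
      then Max {i. i < n \<and> (i, j) \<notin> M_roots n D \<and> i \<notin> basic_perm n D ` {..<j}}
      else j)"

declare basic_perm.simps [simp del]

section \<open>Matrix groups and spaces\<close>

definition general_linear :: "nat \<Rightarrow> 'k::field mat set" where
  "general_linear n = {g \<in> carrier_mat n n. invertible_mat g}"

definition borel_subgroup :: "nat \<Rightarrow> 'k::field mat set" where
  "borel_subgroup n = {b \<in> general_linear n. upper_triangular b}"

definition upper_unitriangular :: "nat \<Rightarrow> 'k::field mat set" where
  "upper_unitriangular n =
     {g \<in> carrier_mat n n. upper_triangular g \<and> (\<forall>i<n. g $$ (i, i) = 1)}"

definition lower_unitriangular :: "nat \<Rightarrow> 'k::field mat set" where
  "lower_unitriangular n =
     {g \<in> carrier_mat n n. (\<forall>i<n. \<forall>j<n. i < j \<longrightarrow> g $$ (i, j) = 0) \<and> (\<forall>i<n. g $$ (i, i) = 1)}"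

text \<open>The space \<open>n\<^sub>-\<close> of strictly lower triangular matrices.\<close>

definition strictly_lower :: "nat \<Rightarrow> 'k::field mat set" where
  "strictly_lower n =
     {X \<in> carrier_mat n n. \<forall>i<n. \<forall>j<n. i \<le> j \<longrightarrow> X $$ (i, j) = 0}"

definition strictly_lower_part :: "'k::field mat \<Rightarrow> 'k mat" where
  "strictly_lower_part A =
     mat (dim_row A) (dim_col A) (\<lambda>(i, j). if j < i then A $$ (i, j) else 0)"

section \<open>Polynomial functions and the Zariski topology\<close>

text \<open>
  A polynomial in variables \<open>x\<^bsub>ij\<^esub>\<close> is a finitely supported map from monomials (finitely
  supported exponent maps) to coefficients; \<open>x\<^bsub>ij\<^esub>\<close> is the coordinate function
  \<open>X \<mapsto> X $$ (i, j)\<close>.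
\<close>

type_synonym 'k matpoly = "((nat \<times> nat) \<Rightarrow>\<^sub>0 nat) \<Rightarrow>\<^sub>0 'k"

definition polys_in :: "(nat \<times> nat) set \<Rightarrow> 'k::field matpoly set" where
  "polys_in V = {p. \<forall>m\<in>Poly_Mapping.keys p. Poly_Mapping.keys m \<subseteq> V}"

definition poly_value :: "'k::field matpoly \<Rightarrow> 'k mat \<Rightarrow> 'k" where
  "poly_value p X =
     (\<Sum>m\<in>Poly_Mapping.keys p. Poly_Mapping.lookup p m *
        (\<Prod>v\<in>Poly_Mapping.keys m. (X $$ v) ^ Poly_Mapping.lookup m v))"

definition zero_locus :: "'k::field mat set \<Rightarrow> 'k matpoly set \<Rightarrow> 'k mat set" where
  "zero_locus A P = {X \<in> A. \<forall>p\<in>P. poly_value p X = 0}"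

definition closed_strictly_lower :: "nat \<Rightarrow> 'k::field mat set \<Rightarrow> bool" where
  "closed_strictly_lower n C \<longleftrightarrow>
     (\<exists>P \<subseteq> polys_in (pos_roots n). C = zero_locus (strictly_lower n) P)"

text \<open>
  Regular functions on \<open>GL(n)\<close> may have powers of \<open>det\<close> as denominators; clearing these does
  not change zero sets, so polynomials in the entries suffice.
\<close>

definition closed_general_linear :: "nat \<Rightarrow> 'k::field mat set \<Rightarrow> bool" where
  "closed_general_linear n C \<longleftrightarrow>
     (\<exists>P \<subseteq> polys_in ({..<n} \<times> {..<n}). C = zero_locus (general_linear n) P)"

section \<open>Basic varieties and basic cones\<close>

definition left_right_action :: "'k::field mat \<Rightarrow> 'k mat \<Rightarrow> 'k mat \<Rightarrow> 'k mat" where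
  "left_right_action g h X = strictly_lower_part (g * X * the (mat_inverse h))"

text \<open>\<open>X\<^bsub>D,\<phi>\<^esub>\<close>, the sum of the multiples \<open>\<phi> \<xi>\<close> of the matrix units at the places \<open>\<xi> \<in> D\<close>.\<close>

definition basic_matrix :: "nat \<Rightarrow> (nat \<times> nat) set \<Rightarrow> (nat \<times> nat \<Rightarrow> 'k::field) \<Rightarrow> 'k mat" where
  "basic_matrix n D \<phi> = mat n n (\<lambda>\<xi>. if \<xi> \<in> D then \<phi> \<xi> else 0)"

definition basic_variety :: "nat \<Rightarrow> (nat \<times> nat) set \<Rightarrow> (nat \<times> nat \<Rightarrow> 'k::field) \<Rightarrow> 'k mat set" where
  "basic_variety n D \<phi> =
     {left_right_action g h (basic_matrix n D \<phi>) | g h.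
        g \<in> upper_unitriangular n \<and> h \<in> upper_unitriangular n}"

definition basic_cell :: "nat \<Rightarrow> (nat \<times> nat) set \<Rightarrow> 'k::field mat set" where
  "basic_cell n D = (\<Union>\<phi>\<in>{\<phi>. \<forall>\<xi>\<in>D. \<phi> \<xi> \<noteq> 0}. basic_variety n D \<phi>)"

definition basic_cone :: "nat \<Rightarrow> (nat \<times> nat) set \<Rightarrow> 'k::field mat set" where
  "basic_cone n D = closed_strictly_lower n hull basic_cell n D"

section \<open>The flag variety and Schubert varieties\<close>

text \<open>Points of \<open>G/B\<close> are the left cosets \<open>g B\<close>, as sets of matrices.\<close>

definition flag_of :: "nat \<Rightarrow> 'k::field mat \<Rightarrow> 'k mat set" where
  "flag_of n g = {g * b | b. b \<in> borel_subgroup n}"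

definition flag_variety :: "nat \<Rightarrow> 'k::field mat set set" where
  "flag_variety n = flag_of n ` general_linear n"

text \<open>The Zariski topology of \<open>G/B\<close> is the quotient topology of that of \<open>G\<close>.\<close>

definition closed_flag :: "nat \<Rightarrow> 'k::field mat set set \<Rightarrow> bool" where
  "closed_flag n C \<longleftrightarrow> C \<subseteq> flag_variety n \<and>
     closed_general_linear n {g \<in> general_linear n. flag_of n g \<in> C}"

definition perm_matrix :: "nat \<Rightarrow> (nat \<Rightarrow> nat) \<Rightarrow> 'k::field mat" where
  "perm_matrix n w = mat n n (\<lambda>(i, j). if i = w j then 1 else 0)"

definition schubert_cell :: "nat \<Rightarrow> (nat \<Rightarrow> nat) \<Rightarrow> 'k::field mat set set" where
  "schubert_cell n w =
     {flag_of n (b * perm_matrix n w * b') | b b'. b \<in> borel_subgroup n \<and> b' \<in> borel_subgroup n}"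

definition schubert_variety :: "nat \<Rightarrow> (nat \<Rightarrow> nat) \<Rightarrow> 'k::field mat set set" where
  "schubert_variety n w = closed_flag n hull schubert_cell n w"

definition main_nbhd :: "nat \<Rightarrow> 'k::field mat set set" where
  "main_nbhd n =
     {flag_of n (u * b) | u b. u \<in> lower_unitriangular n \<and> b \<in> borel_subgroup n}"

definition Psi :: "nat \<Rightarrow> 'k::field mat set \<Rightarrow> 'k mat" where
  "Psi n g = (THE X. X \<in> strictly_lower n \<and> g = flag_of n (1\<^sub>m n + X))"

text \<open>\<open>Y\<^sub>w\<close>, the part of the Schubert variety in the main affine neighborhood, moved to \<open>n\<^sub>-\<close>.\<close>

definition schubert_chart :: "nat \<Rightarrow> (nat \<Rightarrow> nat) \<Rightarrow> 'k::field mat set" where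
  "schubert_chart n w = Psi n ` (schubert_variety n w \<inter> main_nbhd n)"

section \<open>Cones, homogeneous elements, tangent cones\<close>

definition is_cone :: "nat \<Rightarrow> 'k::field mat set \<Rightarrow> bool" where
  "is_cone n C \<longleftrightarrow> 0\<^sub>m n n \<in> C \<and> (\<forall>t. \<forall>X\<in>C. t \<cdot>\<^sub>m X \<in> C)"

text \<open>The definition depends on the field, hence the type argument.\<close>

definition homogeneous :: "'k::field itself \<Rightarrow> nat \<Rightarrow> (nat \<Rightarrow> nat) \<Rightarrow> bool" where
  "homogeneous K n w \<longleftrightarrow>
     w permutes {..<n} \<and> is_cone n (schubert_chart n w :: 'k mat set)"

definition monom_degree :: "((nat \<times> nat) \<Rightarrow>\<^sub>0 nat) \<Rightarrow> nat" where
  "monom_degree m = (\<Sum>v\<in>Poly_Mapping.keys m. Poly_Mapping.lookup m v)"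

definition homogeneous_part :: "nat \<Rightarrow> 'k::field matpoly \<Rightarrow> 'k matpoly" where
  "homogeneous_part d p =
     (\<Sum>m\<in>{m \<in> Poly_Mapping.keys p. monom_degree m = d}.
        Poly_Mapping.single m (Poly_Mapping.lookup p m))"

text \<open>The homogeneous part of lowest degree; for \<open>p = 0\<close> it is \<open>0\<close>, whatever \<open>LEAST\<close> returns.\<close>

definition initial_form :: "'k::field matpoly \<Rightarrow> 'k matpoly" where
  "initial_form p = homogeneous_part (LEAST d. homogeneous_part d p \<noteq> 0) p"

definition vanishing_ideal :: "nat \<Rightarrow> 'k::field mat set \<Rightarrow> 'k matpoly set" where
  "vanishing_ideal n Y = {p \<in> polys_in (pos_roots n). \<forall>X\<in>Y. poly_value p X = 0}"

text \<open>Tangent cone at the origin of a subvariety of the affine space \<open>n\<^sub>-\<close>.\<close>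

definition tangent_cone_at_0 :: "nat \<Rightarrow> 'k::field mat set \<Rightarrow> 'k mat set" where
  "tangent_cone_at_0 n Y = zero_locus (strictly_lower n) (initial_form ` vanishing_ideal n Y)"

text \<open>Tangent cone of the Schubert variety at \<open>p\<close>, read in the chart \<open>Psi\<close>, which sends \<open>p\<close> to \<open>0\<close>.\<close>

definition schubert_tangent_cone :: "nat \<Rightarrow> (nat \<Rightarrow> nat) \<Rightarrow> 'k::field mat set" where
  "schubert_tangent_cone n w = tangent_cone_at_0 n (schubert_chart n w)"

end

theory Submission
  imports Defs "Jordan_Normal_Form.Determinant" "HOL-Computational_Algebra.Polynomial"
begin

text \<open>
  Let \<open>B\<close> be the group of invertible upper triangular matrices, write \<open>low Z\<close> for the strictly
  lower triangular part of \<open>Z\<close>, let \<open>D(w) = {(w j, j) | j < w j}\<close> be the excedance set of a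
  permutation \<open>w\<close>, and let \<open>A\<^sub>w\<close> be the set of those \<open>X\<close> in \<open>n\<^sub>-\<close> with \<open>1 + X \<in> B w B\<close>.

  Both sides of the first claim are closures.  By definition \<open>V\<^sub>D\<close> is the closure of the basic cell,
  and \<open>Y\<^sub>w\<close> is the closure of \<open>A\<^sub>w\<close>, because the big cell is open in the flag variety, with
  coordinates that are quotients of minors (\<open>chart_cell_dense\<close>).  Since \<open>low (b Z c)\<close> depends only
  on \<open>low Z\<close> for \<open>b, c \<in> B\<close>, the basic cell of \<open>D\<close> is the set of all \<open>low (b w c)\<close>, for any \<open>w\<close>
  with \<open>D(w) = D\<close>.  As distinct basic subsets have disjoint cells, the Bruhat decomposition of
  \<open>1 + X\<close> shows that the basic cell of \<open>D\<close> is the union of all \<open>A\<^sub>v\<close> with \<open>D(v) = D\<close>.  Hence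
  \<open>V\<^sub>D = Y\<^sub>w\<close> as soon as \<open>D(w) = D\<close> and \<open>w\<close> is the largest such permutation in the Bruhat order.

  The largest one is \<open>w\<^sub>D\<close>.  Call \<open>k < l\<close> a crossing of \<open>v\<close> if \<open>v k < v l \<le> k\<close>.  Exchanging the values
  at \<open>k\<close> and \<open>l\<close> keeps the excedances and makes \<open>v\<close> larger in the Bruhat order
  (\<open>transpose_degeneration\<close>, \<open>excedances_uncross\<close>); a permutation without crossings satisfies the
  greedy recursion that defines \<open>w\<^sub>D\<close> (\<open>noncrossing_eq_basic_perm\<close>).

  A basic cell is stable under nonzero scalars, so \<open>V\<^sub>D\<close> is a cone and \<open>w\<^sub>D\<close> is homogeneous.  The ideal of
  a cone is homogeneous, so a closed cone is its own tangent cone.  What remains is that every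
  homogeneous \<open>w\<close> is some \<open>w\<^sub>D\<close>, that is, has no crossing.  Given a crossing \<open>k < l\<close> of \<open>w\<close>, there are
  \<open>v \<le> w\<close> and \<open>m\<close> with \<open>v m < m < v\<inverse> m\<close> such that, for some \<open>p\<close> with \<open>v m < p \<le> m\<close>, the blocks
  of \<open>v\<close> and \<open>w\<close> consisting of the rows from \<open>p\<close> on and the columns up to \<open>m\<close> have the same rank \<open>r\<close>.
  Choose \<open>X \<in> A\<^sub>v\<close>, so \<open>1 + X = b v c\<close>.  Then
  \<open>b\<inverse> (1 + t X) c\<inverse> = t v + (1 - t) u\<close> with \<open>u = b\<inverse> c\<inverse>\<close> upper triangular.  If \<open>Y\<^sub>w\<close> is a cone, the
  block of this matrix has rank at most \<open>r\<close> for all \<open>t\<close>.  But one of its minors of size \<open>r + 1\<close> is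
  \<open>(1 - t)\<close> times a polynomial in \<open>t\<close> whose value at \<open>t = 1\<close> is the nonzero diagonal entry \<open>u\<^sub>m\<^sub>m\<close>
  (\<open>not_cone_of_double_descent\<close>).
\<close>

section \<open>Algebras of functions\<close>

text \<open>
  Several kinds of functions occur as compositions with polynomials and determinants: polynomial
  functions of one parameter, polynomial functions of a matrix, and quotients of these.  All that
  is used about them is that they are closed under constants, sums and products.
\<close>

definition function_algebra :: "('a \<Rightarrow> 'k::comm_ring_1) set \<Rightarrow> bool" where
  "function_algebra A \<longleftrightarrow> (\<forall>c. (\<lambda>_. c) \<in> A) \<and>
     (\<forall>f\<in>A. \<forall>g\<in>A. (\<lambda>x. f x + g x) \<in> A \<and> (\<lambda>x. f x * g x) \<in> A)"

lemma function_algebra_const: "function_algebra A \<Longrightarrow> (\<lambda>_. c) \<in> A"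
  and function_algebra_add: "function_algebra A \<Longrightarrow> f \<in> A \<Longrightarrow> g \<in> A \<Longrightarrow> (\<lambda>x. f x + g x) \<in> A"
  and function_algebra_mult: "function_algebra A \<Longrightarrow> f \<in> A \<Longrightarrow> g \<in> A \<Longrightarrow> (\<lambda>x. f x * g x) \<in> A"
  by (auto simp: function_algebra_def)

lemma function_algebra_sum:
  assumes "function_algebra A" "\<And>i. i \<in> I \<Longrightarrow> f i \<in> A"
  shows "(\<lambda>x. \<Sum>i\<in>I. f i x) \<in> A"
  using assms(2)
  by (induction I rule: infinite_finite_induct)
    (auto intro: function_algebra_const function_algebra_add assms(1))

lemma function_algebra_prod:
  assumes "function_algebra A" "\<And>i. i \<in> I \<Longrightarrow> f i \<in> A"
  shows "(\<lambda>x. \<Prod>i\<in>I. f i x) \<in> A"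
  using assms(2)
  by (induction I rule: infinite_finite_induct)
    (auto intro: function_algebra_const function_algebra_mult assms(1))

lemma function_algebra_power:
  assumes "function_algebra A" "f \<in> A"
  shows "(\<lambda>x. f x ^ k) \<in> A"
  by (induction k) (auto intro: function_algebra_const function_algebra_mult assms)

lemma function_algebra_det:
  assumes A: "function_algebra A" and G: "\<And>x. G x \<in> carrier_mat m m"
    and e: "\<And>i j. i < m \<Longrightarrow> j < m \<Longrightarrow> (\<lambda>x. G x $$ (i, j)) \<in> A"
  shows "(\<lambda>x. det (G x)) \<in> A"
proof -
  have "(\<lambda>x. det (G x)) =
      (\<lambda>x. \<Sum>p\<in>{p. p permutes {0..<m}}. signof p * (\<Prod>i = 0..<m. G x $$ (i, p i)))"
    by (rule ext, rule det_def'[OF G])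
  moreover have "\<dots> \<in> A"
    by (intro function_algebra_sum function_algebra_mult function_algebra_prod
        function_algebra_const A e) (auto simp: permutes_in_image[where S="{0..<m}"] dest: permutes_in_image)
  ultimately show ?thesis by simp
qed

lemma function_algebra_poly_value:
  assumes A: "function_algebra A" and p: "p \<in> polys_in V"
    and e: "\<And>v. v \<in> V \<Longrightarrow> (\<lambda>x. G x $$ v) \<in> A"
  shows "(\<lambda>x. poly_value p (G x)) \<in> A"
  unfolding poly_value_def
  using p by (intro function_algebra_sum function_algebra_mult function_algebra_prod
      function_algebra_power function_algebra_const A e) (auto simp: polys_in_def)

lemma function_algebra_poly: "function_algebra (range (poly :: 'k::comm_ring_1 poly \<Rightarrow> _))"
proof -
  have "(\<lambda>_. c) \<in> range poly" for c :: 'k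
    by (rule range_eqI[of _ _ "[:c:]"]) auto
  moreover have "(\<lambda>x. poly p x + poly q x) \<in> range poly"
      "(\<lambda>x. poly p x * poly q x) \<in> range poly" for p q :: "'k poly"
    by (rule range_eqI[of _ _ "p + q"], auto) (rule range_eqI[of _ _ "p * q"], auto)
  ultimately show ?thesis by (auto simp: function_algebra_def)
qed

lemma poly_function_id: "(\<lambda>t. t) \<in> range (poly :: 'k::comm_ring_1 poly \<Rightarrow> _)"
  by (rule range_eqI[of _ _ "[:0, 1:]"]) auto

text \<open>
  The form in which irreducibility of the affine line enters: an identity that holds along a curve
  except at one parameter value holds at that value too.
\<close>

lemma poly_function_eq_0:
  fixes f :: "'k::{field_char_0} \<Rightarrow> 'k"
  assumes "f \<in> range poly" and "\<And>t. t \<noteq> c \<Longrightarrow> f t = 0"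
  shows "f t = 0"
proof -
  obtain p where p: "f = poly p" using assms(1) by auto
  have "infinite (- {c})" by (simp add: infinite_UNIV_char_0 Compl_eq_Diff_UNIV)
  moreover have "- {c} \<subseteq> {x. poly p x = 0}" using assms(2) p by auto
  ultimately have "p = 0" using poly_roots_finite finite_subset by metis
  then show ?thesis using p by simp
qed

section \<open>Polynomial functions on matrices\<close>

definition poly_functions :: "(nat \<times> nat) set \<Rightarrow> ('k::field mat \<Rightarrow> 'k) set" where
  "poly_functions V = poly_value ` polys_in V"

text \<open>
  Summing over a larger set of monomials allows the sum of two polynomials to be evaluated over
  a common set.
\<close>

lemma poly_value_superset:
  assumes "finite S" "Poly_Mapping.keys p \<subseteq> S"
  shows "poly_value p X = (\<Sum>m\<in>S. Poly_Mapping.lookup p m *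
        (\<Prod>v\<in>Poly_Mapping.keys m. (X $$ v) ^ Poly_Mapping.lookup m v))"
  unfolding poly_value_def using assms
  by (intro sum.mono_neutral_left) (auto simp: in_keys_iff)

lemma poly_value_0 [simp]: "poly_value 0 X = 0"
  by (simp add: poly_value_def)

lemma poly_value_add: "poly_value (p + q) X = poly_value p X + poly_value q X"
proof -
  let ?S = "Poly_Mapping.keys p \<union> Poly_Mapping.keys q"
  have "Poly_Mapping.keys (p + q) \<subseteq> ?S" by (rule Poly_Mapping.keys_add)
  then show ?thesis
    by (simp add: poly_value_superset[of ?S] lookup_add sum.distrib distrib_right)
qed

lemma poly_value_sum: "poly_value (\<Sum>i\<in>I. f i) X = (\<Sum>i\<in>I. poly_value (f i) X)"
  by (induction I rule: infinite_finite_induct) (auto simp: poly_value_add)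

lemma poly_value_single:
  "poly_value (Poly_Mapping.single m c) X =
     c * (\<Prod>v\<in>Poly_Mapping.keys m. (X $$ v) ^ Poly_Mapping.lookup m v)"
  by (cases "c = 0") (auto simp: poly_value_def)

lemma monomial_value_add:
  fixes X :: "'k::field mat"
  shows "(\<Prod>v\<in>Poly_Mapping.keys (m + m'). (X $$ v) ^ Poly_Mapping.lookup (m + m') v) =
    (\<Prod>v\<in>Poly_Mapping.keys m. (X $$ v) ^ Poly_Mapping.lookup m v) *
    (\<Prod>v\<in>Poly_Mapping.keys m'. (X $$ v) ^ Poly_Mapping.lookup m' v)"
proof -
  let ?S = "Poly_Mapping.keys m \<union> Poly_Mapping.keys m'"
  have S: "(\<Prod>v\<in>Poly_Mapping.keys u. (X $$ v) ^ Poly_Mapping.lookup u v) =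
      (\<Prod>v\<in>?S. (X $$ v) ^ Poly_Mapping.lookup u v)"
    if "Poly_Mapping.keys u \<subseteq> ?S" for u
    using that by (intro prod.mono_neutral_left) (auto simp: in_keys_iff)
  show ?thesis
    unfolding S[OF Poly_Mapping.keys_add] S[OF Un_upper1] S[OF Un_upper2]
    by (simp add: lookup_add power_add prod.distrib)
qed

lemma poly_mapping_sum_single:
  "(\<Sum>m\<in>Poly_Mapping.keys p. Poly_Mapping.single m (Poly_Mapping.lookup p m)) = p"
  by (rule poly_mapping_eqI)
    (simp add: lookup_sum lookup_single when_def sum.delta in_keys_iff)

lemma poly_value_mult: "poly_value (p * q) X = poly_value p X * poly_value q X"
proof -
  have "p * q = (\<Sum>a\<in>Poly_Mapping.keys p. Poly_Mapping.single a (Poly_Mapping.lookup p a)) *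
      (\<Sum>b\<in>Poly_Mapping.keys q. Poly_Mapping.single b (Poly_Mapping.lookup q b))"
    by (simp add: poly_mapping_sum_single)
  also have "poly_value \<dots> X = poly_value p X * poly_value q X"
    unfolding sum_product poly_value_sum mult_single poly_value_single monomial_value_add
    by (simp add: poly_value_def sum_product mult_ac)
  finally show ?thesis .
qed

lemma function_algebra_poly_functions:
  "function_algebra (poly_functions V :: ('k::field mat \<Rightarrow> 'k) set)"
proof -
  have "(\<lambda>_. c) \<in> poly_functions V" for c :: 'k
    unfolding poly_functions_def
    by (rule image_eqI[of _ _ "Poly_Mapping.single 0 c"])
      (auto simp: poly_value_single polys_in_def fun_eq_iff)
  moreover have "(\<lambda>x. poly_value p x + poly_value q x) \<in> poly_functions V"
    if "p \<in> polys_in V" "q \<in> polys_in V" for p q :: "'k matpoly"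
    unfolding poly_functions_def
    using that Poly_Mapping.keys_add[of p q]
    by (intro image_eqI[of _ _ "p + q"]) (auto simp: poly_value_add polys_in_def fun_eq_iff)
  moreover have "(\<lambda>x. poly_value p x * poly_value q x) \<in> poly_functions V"
    if pq: "p \<in> polys_in V" "q \<in> polys_in V" for p q :: "'k matpoly"
  proof -
    have "Poly_Mapping.keys m \<subseteq> V" if m: "m \<in> Poly_Mapping.keys (p * q)" for m
    proof -
      obtain a b where "a \<in> Poly_Mapping.keys p" "b \<in> Poly_Mapping.keys q" "m = a + b"
        using Poly_Mapping.keys_mult[of p q] m by blast
      then have "Poly_Mapping.keys a \<subseteq> V" "Poly_Mapping.keys b \<subseteq> V"
        using pq by (auto simp: polys_in_def)
      then show ?thesis using \<open>m = a + b\<close> Poly_Mapping.keys_add[of a b] by blast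
    qed
    then show ?thesis
      unfolding poly_functions_def
      by (intro image_eqI[of _ _ "p * q"]) (auto simp: poly_value_mult polys_in_def fun_eq_iff)
  qed
  ultimately show ?thesis by (auto simp: function_algebra_def poly_functions_def)
qed

lemma coordinate_poly_function: "v \<in> V \<Longrightarrow> (\<lambda>X. X $$ v) \<in> poly_functions V"
  unfolding poly_functions_def
  by (rule image_eqI[of _ _ "Poly_Mapping.single (Poly_Mapping.single v 1) 1"])
    (auto simp: poly_value_single polys_in_def fun_eq_iff)

lemma function_algebra_compose:
  assumes "function_algebra A" and "F \<in> poly_functions V"
    and "\<And>v. v \<in> V \<Longrightarrow> (\<lambda>x. G x $$ v) \<in> A"
  shows "(\<lambda>x. F (G x)) \<in> A"
  using assms function_algebra_poly_value[of A _ V G] by (auto simp: poly_functions_def)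

section \<open>Triangular matrices\<close>

lemma mult_entry:
  assumes "A \<in> carrier_mat n m" "B \<in> carrier_mat m k" "i < n" "j < k"
  shows "(A * B) $$ (i, j) = (\<Sum>l<m. A $$ (i, l) * B $$ (l, j))"
  using assms by (auto simp: scalar_prod_def atLeast0LessThan)

lemma sum_single_term:
  fixes f :: "nat \<Rightarrow> 'k::comm_monoid_add"
  assumes "i < n" "\<And>l. l < n \<Longrightarrow> l \<noteq> i \<Longrightarrow> f l = 0"
  shows "(\<Sum>l<n. f l) = f i"
  using assms by (subst sum.remove[of _ i]) (auto intro: sum.neutral)

lemma upper_triangular_mult:
  fixes A :: "'k::field mat"
  assumes A: "A \<in> carrier_mat n n" "upper_triangular A"
    and B: "B \<in> carrier_mat n n" "upper_triangular B"
  shows "upper_triangular (A * B)"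
proof (rule upper_triangularI)
  fix i j assume ij: "j < i" "i < dim_row (A * B)"
  have "A $$ (i, l) * B $$ (l, j) = 0" if "l < n" for l
    using ij that A B by (cases "l < i") (auto simp: upper_triangular_def)
  then have "(\<Sum>l<n. A $$ (i, l) * B $$ (l, j)) = 0" by (intro sum.neutral) simp
  then show "(A * B) $$ (i, j) = 0"
    using ij A B by (subst mult_entry[of _ n n _ n]) auto
qed

lemma upper_triangular_mult_diag:
  fixes A :: "'k::field mat"
  assumes A: "A \<in> carrier_mat n n" "upper_triangular A"
    and B: "B \<in> carrier_mat n n" "upper_triangular B" and i: "i < n"
  shows "(A * B) $$ (i, i) = A $$ (i, i) * B $$ (i, i)"
proof -
  have "A $$ (i, l) * B $$ (l, i) = 0" if "l < n" "l \<noteq> i" for l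
    using i that A B by (cases "l < i") (auto simp: upper_triangular_def)
  then have "(\<Sum>l<n. A $$ (i, l) * B $$ (l, i)) = A $$ (i, i) * B $$ (i, i)"
    by (intro sum_single_term i)
  then show ?thesis using i by (subst mult_entry[OF A(1) B(1)]) auto
qed

text \<open>
  Comparing the entries of \<open>A C = 1\<close> below the diagonal, the last row first, expresses each entry of
  \<open>C\<close> below the diagonal by those further down in its column, which vanish.
\<close>

lemma inverse_upper_triangular:
  fixes A :: "'k::field mat"
  assumes A: "A \<in> carrier_mat n n" "upper_triangular A" and C: "C \<in> carrier_mat n n"
    and AC: "A * C = 1\<^sub>m n" and d: "\<And>i. i < n \<Longrightarrow> A $$ (i, i) \<noteq> 0"
  shows "upper_triangular C"
proof (rule upper_triangularI)
  fix i j assume "j < i" "i < dim_row C"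
  then have "i < n" using C by simp
  with \<open>j < i\<close> show "C $$ (i, j) = 0"
  proof (induction "n - i" arbitrary: i rule: less_induct)
    case less
    have "A $$ (i, l) * C $$ (l, j) = 0" if "l < n" "l \<noteq> i" for l
    proof (cases "l < i")
      case True then show ?thesis using A less.prems by (auto simp: upper_triangular_def)
    next
      case False
      then have "C $$ (l, j) = 0" using that less.prems by (intro less.hyps) auto
      then show ?thesis by simp
    qed
    then have "(\<Sum>l<n. A $$ (i, l) * C $$ (l, j)) = A $$ (i, i) * C $$ (i, j)"
      using less.prems by (intro sum_single_term) auto
    moreover have "(\<Sum>l<n. A $$ (i, l) * C $$ (l, j)) = 0"
      using less.prems arg_cong[OF AC, of "\<lambda>M. M $$ (i, j)"]
      by (subst (asm) mult_entry[OF A(1) C]) auto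
    ultimately show ?case using d less.prems by simp
  qed
qed

lemma invertible_mat_iff_det:
  fixes A :: "'k::field mat"
  assumes A: "A \<in> carrier_mat n n"
  shows "invertible_mat A \<longleftrightarrow> det A \<noteq> 0"
proof
  assume "invertible_mat A"
  then obtain B where B': "inverts_mat A B" "inverts_mat B A"
    unfolding invertible_mat_def by blast
  have AB: "A * B = 1\<^sub>m n" and BA: "B * A = 1\<^sub>m (dim_row B)"
    using B' carrier_matD(1)[OF A] unfolding inverts_mat_def by simp_all
  have B: "B \<in> carrier_mat n n"
  proof
    show "dim_row B = n" using arg_cong[OF BA, of dim_col] carrier_matD(2)[OF A] by simp
    show "dim_col B = n" using arg_cong[OF AB, of dim_col] by simp
  qed
  show "det A \<noteq> 0" using arg_cong[OF AB, of det] det_mult[OF A B] by auto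
next
  assume d: "det A \<noteq> 0"
  let ?B = "(1 / det A) \<cdot>\<^sub>m adj_mat A"
  have "(1 / det A) \<cdot>\<^sub>m (det A \<cdot>\<^sub>m 1\<^sub>m n) = (1\<^sub>m n :: 'k mat)"
    using d by (intro eq_matI) auto
  then have "A * ?B = 1\<^sub>m n" "?B * A = 1\<^sub>m n"
    by (simp_all only: mult_smult_distrib[OF A adj_mat(1)[OF A]]
      mult_smult_assoc_mat[OF adj_mat(1)[OF A] A] adj_mat(2,3)[OF A])
  moreover have "dim_row A = n" "dim_col A = n" "dim_row ?B = n"
    using A adj_mat(1)[OF A] by auto
  ultimately have "inverts_mat A ?B" "inverts_mat ?B A" "square_mat A"
    unfolding inverts_mat_def by simp_all
  then show "invertible_mat A" unfolding invertible_mat_def by blast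
qed

lemma general_linear_iff:
  "g \<in> general_linear n \<longleftrightarrow> g \<in> carrier_mat n n \<and> det g \<noteq> 0"
  by (auto simp: general_linear_def invertible_mat_iff_det)

lemma general_linear_carrier: "g \<in> general_linear n \<Longrightarrow> g \<in> carrier_mat n n"
  by (simp add: general_linear_def)

lemma general_linear_mult:
  "g \<in> general_linear n \<Longrightarrow> h \<in> general_linear n \<Longrightarrow> g * h \<in> general_linear n"
  by (auto simp: general_linear_iff det_mult)

lemma general_linear_inverse:
  assumes "g \<in> general_linear n"
  obtains h where "h \<in> general_linear n" "g * h = 1\<^sub>m n" "h * g = 1\<^sub>m n"
proof -
  from assms have g: "g \<in> carrier_mat n n" "invertible_mat g" by (auto simp: general_linear_def)
  then obtain h where h': "inverts_mat g h" "inverts_mat h g"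
    unfolding invertible_mat_def by blast
  have gh: "g * h = 1\<^sub>m n" and hg: "h * g = 1\<^sub>m (dim_row h)"
    using h' carrier_matD(1)[OF g(1)] unfolding inverts_mat_def by simp_all
  have h: "h \<in> carrier_mat n n"
  proof
    show "dim_row h = n" using arg_cong[OF hg, of dim_col] carrier_matD(2)[OF g(1)] by simp
    show "dim_col h = n" using arg_cong[OF gh, of dim_col] by simp
  qed
  have "det h \<noteq> 0" using arg_cong[OF gh, of det] det_mult[OF g(1) h] by auto
  then have "h \<in> general_linear n" using h by (simp add: general_linear_iff)
  moreover have "h * g = 1\<^sub>m n" using hg carrier_matD(1)[OF h] by simp
  ultimately show ?thesis using that gh by blast
qed

lemma borel_general_linear: "b \<in> borel_subgroup n \<Longrightarrow> b \<in> general_linear n"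
  by (simp add: borel_subgroup_def)

lemma borel_carrier: "b \<in> borel_subgroup n \<Longrightarrow> b \<in> carrier_mat n n"
  by (simp add: borel_subgroup_def general_linear_carrier)

lemma borel_upper_triangular: "b \<in> borel_subgroup n \<Longrightarrow> upper_triangular b"
  by (simp add: borel_subgroup_def)

lemma borel_iff:
  "b \<in> borel_subgroup n \<longleftrightarrow>
     b \<in> carrier_mat n n \<and> upper_triangular b \<and> (\<forall>i<n. b $$ (i, i) \<noteq> 0)"
proof (cases "b \<in> carrier_mat n n \<and> upper_triangular b")
  case True
  then have "det b = 0 \<longleftrightarrow> 0 \<in> set (diag_mat b)" by (intro upper_triangular_imp_det_eq_0_iff) auto
  also have "\<dots> \<longleftrightarrow> (\<exists>i<n. b $$ (i, i) = 0)" using True by (force simp: diag_mat_def)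
  finally show ?thesis using True by (auto simp: borel_subgroup_def general_linear_iff)
qed (auto simp: borel_subgroup_def general_linear_carrier)

lemma one_borel [simp]: "1\<^sub>m n \<in> borel_subgroup n"
  by (auto simp: borel_iff)

lemma borel_mult:
  "b \<in> borel_subgroup n \<Longrightarrow> c \<in> borel_subgroup n \<Longrightarrow> b * c \<in> borel_subgroup n"
  by (auto simp: borel_subgroup_def intro: general_linear_mult
      upper_triangular_mult[OF general_linear_carrier _ general_linear_carrier])

lemma borel_inverse:
  assumes "b \<in> borel_subgroup n"
  obtains c where "c \<in> borel_subgroup n" "b * c = 1\<^sub>m n" "c * b = 1\<^sub>m n"
proof -
  obtain c where c: "c \<in> general_linear n" "b * c = 1\<^sub>m n" "c * b = 1\<^sub>m n"
    using general_linear_inverse[OF borel_general_linear[OF assms]] .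
  moreover have "upper_triangular c"
    using assms c by (intro inverse_upper_triangular[of b n c]) (auto simp: borel_iff general_linear_carrier)
  ultimately show ?thesis using that by (auto simp: borel_subgroup_def)
qed

lemma smult_borel: "b \<in> borel_subgroup n \<Longrightarrow> t \<noteq> 0 \<Longrightarrow> t \<cdot>\<^sub>m b \<in> borel_subgroup n"
  by (auto simp: borel_iff upper_triangular_def)

lemma upper_unitriangular_borel: "g \<in> upper_unitriangular n \<Longrightarrow> g \<in> borel_subgroup n"
  by (auto simp: borel_iff upper_unitriangular_def)

lemma upper_unitriangular_inverse:
  assumes h: "h \<in> upper_unitriangular n"
  obtains c where "c \<in> upper_unitriangular n" "h * c = 1\<^sub>m n" "c * h = 1\<^sub>m n"
    "mat_inverse h = Some c"
proof -
  have hc: "h \<in> carrier_mat n n" "upper_triangular h"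
    using h by (auto simp: upper_unitriangular_def)
  obtain c where c: "c \<in> borel_subgroup n" "h * c = 1\<^sub>m n" "c * h = 1\<^sub>m n"
    using borel_inverse[OF upper_unitriangular_borel[OF h]] .
  have "c $$ (i, i) = 1" if "i < n" for i
    using upper_triangular_mult_diag[OF hc borel_carrier[OF c(1)] borel_upper_triangular[OF c(1)] that]
      h c that by (auto simp: upper_unitriangular_def)
  then have cu: "c \<in> upper_unitriangular n"
    using c by (auto simp: upper_unitriangular_def borel_iff)
  have "mat_inverse h \<noteq> None"
  proof
    assume "mat_inverse h = None"
    from mat_inverse(1)[OF hc(1) this, of "()"] have "h \<notin> Units (ring_mat TYPE('a) n ())" .
    moreover have "det h \<noteq> 0"
      using upper_unitriangular_borel[OF h] by (auto simp: borel_subgroup_def general_linear_iff)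
    ultimately show False using det_non_zero_imp_unit[OF hc(1), of "()"] by blast
  qed
  then obtain c' where c': "mat_inverse h = Some c'" by auto
  have "h * c' = 1\<^sub>m n" "c' \<in> carrier_mat n n" using mat_inverse(2)[OF hc(1) c'] by auto
  then have "c' = (c * h) * c'" using c by simp
  also have "\<dots> = c * (h * c')"
    using borel_carrier[OF c(1)] hc \<open>c' \<in> _\<close> by (intro assoc_mult_mat[of _ n n _ n _ n]) auto
  also have "\<dots> = c" using \<open>h * c' = _\<close> borel_carrier[OF c(1)] by simp
  finally show ?thesis using that cu c c' by simp
qed

lemma strictly_lower_add_one:
  assumes "X \<in> strictly_lower n"
  shows "1\<^sub>m n + X \<in> lower_unitriangular n"
  using assms by (auto simp: strictly_lower_def lower_unitriangular_def)

lemma lower_unitriangular_minus_one: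
  fixes L :: "'k::field mat"
  assumes "L \<in> lower_unitriangular n"
  shows "L - 1\<^sub>m n \<in> strictly_lower n" "1\<^sub>m n + (L - 1\<^sub>m n) = L"
  using assms by (auto simp: strictly_lower_def lower_unitriangular_def intro!: eq_matI)

lemma lower_unitriangular_det:
  fixes L :: "'k::field mat"
  assumes "L \<in> lower_unitriangular n"
  shows "det L = 1"
proof -
  have L: "L \<in> carrier_mat n n" using assms by (simp add: lower_unitriangular_def)
  have "det L = prod_list (diag_mat L)"
    using assms L by (intro det_lower_triangular[of n]) (auto simp: lower_unitriangular_def)
  also have "diag_mat L = map (\<lambda>_. 1) [0..<n]"
    using assms L by (auto simp: diag_mat_def lower_unitriangular_def)
  finally show "det L = 1" by (simp add: map_replicate_const)
qed

lemma lower_unitriangular_general_linear: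
  "L \<in> lower_unitriangular n \<Longrightarrow> L \<in> general_linear n"
  using lower_unitriangular_det[of L n] by (auto simp: general_linear_iff lower_unitriangular_def)

text \<open>
  A flag in the main affine neighbourhood has only one representative in \<open>N\<^sub>-\<close>; this makes \<open>\<Psi>\<close>
  well defined.  Row by row, \<open>L\<close> forces the entries of \<open>b\<close> on and above the diagonal to be those of
  the identity.
\<close>

lemma lower_unitriangular_borel_unique:
  fixes b :: "'k::field mat"
  assumes L: "L \<in> lower_unitriangular n" and L': "L' \<in> lower_unitriangular n"
    and b: "b \<in> borel_subgroup n" and eq: "L' = L * b"
  shows "L' = L"
proof -
  have Lc: "L \<in> carrier_mat n n" "L' \<in> carrier_mat n n"
    using L L' by (auto simp: lower_unitriangular_def)
  have "b $$ (i, j) = (if i = j then 1 else 0)" if "i < n" "i \<le> j" "j < n" for i j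
    using that
  proof (induction i arbitrary: j rule: less_induct)
    case (less i)
    have "L $$ (i, l) * b $$ (l, j) = 0" if "l < n" "l \<noteq> i" for l
    proof (cases "l < i")
      case True then show ?thesis using less by auto
    next
      case False then show ?thesis using L that less.prems by (auto simp: lower_unitriangular_def)
    qed
    then have "(\<Sum>l<n. L $$ (i, l) * b $$ (l, j)) = L $$ (i, i) * b $$ (i, j)"
      using less.prems by (intro sum_single_term) auto
    also have "\<dots> = b $$ (i, j)" using L less.prems by (auto simp: lower_unitriangular_def)
    finally have "L' $$ (i, j) = b $$ (i, j)"
      using less.prems borel_carrier[OF b] Lc eq by (simp add: mult_entry[of _ n n _ n] del: index_mult_mat)
    then show ?case using L' less.prems by (auto simp: lower_unitriangular_def)
  qed
  moreover have "b $$ (i, j) = 0" if "j < i" "i < n" for i j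
    using b that by (auto simp: borel_iff upper_triangular_def)
  ultimately have "b = 1\<^sub>m n"
    using borel_carrier[OF b] by (intro eq_matI) (auto, metis not_le_imp_less)
  then show ?thesis using eq Lc by simp
qed

declare borel_carrier [simp]

lemma square_mult_carrier [simp]:
  fixes A :: "'k::field mat"
  shows "A \<in> carrier_mat n n \<Longrightarrow> B \<in> carrier_mat n n \<Longrightarrow> A * B \<in> carrier_mat n n"
  by simp

lemma square_mult_one [simp]:
  fixes A :: "'k::field mat"
  shows "A \<in> carrier_mat n n \<Longrightarrow> 1\<^sub>m n * A = A"
  "A \<in> carrier_mat n n \<Longrightarrow> A * 1\<^sub>m n = A"
  by simp_all

lemma square_mult_assoc:
  fixes A :: "'k::field mat"
  shows "A \<in> carrier_mat n n \<Longrightarrow> B \<in> carrier_mat n n \<Longrightarrow> C \<in> carrier_mat n n \<Longrightarrow>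
     (A * B) * C = A * (B * C)"
  by simp

section \<open>Zariski closures as vanishing conditions\<close>

lemma poly_functions_mono: "V \<subseteq> W \<Longrightarrow> poly_functions V \<subseteq> poly_functions W"
  by (auto simp: poly_functions_def polys_in_def)

text \<open>
  In this form two closures are compared by transporting polynomials from one side to the other.
\<close>

lemma closed_strictly_lower_hull:
  fixes S :: "'k::field mat set"
  assumes "S \<subseteq> strictly_lower n"
  shows "closed_strictly_lower n hull S =
    {X \<in> strictly_lower n. \<forall>F\<in>poly_functions (pos_roots n). (\<forall>Y\<in>S. F Y = 0) \<longrightarrow> F X = 0}"
    (is "_ = ?C")
proof
  let ?P = "{p \<in> polys_in (pos_roots n). \<forall>Y\<in>S. poly_value p Y = 0}"
  have "?C = zero_locus (strictly_lower n) ?P"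
    by (auto simp: zero_locus_def poly_functions_def)
  moreover have "?P \<subseteq> polys_in (pos_roots n)" by auto
  ultimately have "closed_strictly_lower n ?C"
    unfolding closed_strictly_lower_def by (intro exI[of _ ?P] conjI)
  then show "closed_strictly_lower n hull S \<subseteq> ?C"
    using assms by (intro hull_minimal) auto
  show "?C \<subseteq> closed_strictly_lower n hull S"
    unfolding hull_def
  proof (intro Inter_greatest, clarify)
    fix Z X assume Z: "closed_strictly_lower n Z" "S \<subseteq> Z" and X: "X \<in> strictly_lower n"
      "\<forall>F\<in>poly_functions (pos_roots n). (\<forall>Y\<in>S. F Y = 0) \<longrightarrow> F X = 0"
    then show "X \<in> Z"
      unfolding closed_strictly_lower_def zero_locus_def poly_functions_def by fastforce
  qed
qed

definition double_coset :: "nat \<Rightarrow> (nat \<Rightarrow> nat) \<Rightarrow> 'k::field mat set" where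
  "double_coset n w =
     {b * perm_matrix n w * b' | b b'. b \<in> borel_subgroup n \<and> b' \<in> borel_subgroup n}"

text \<open>
  This will be the preimage in \<open>GL(n)\<close> of the Schubert variety.  It replaces the closure in the flag
  variety, where only sets of cosets are available, by vanishing conditions on matrices.
\<close>

definition schubert_preimage :: "nat \<Rightarrow> (nat \<Rightarrow> nat) \<Rightarrow> 'k::field mat set" where
  "schubert_preimage n w =
     {g \<in> general_linear n. \<forall>F\<in>poly_functions ({..<n} \<times> {..<n}).
        (\<forall>h\<in>double_coset n w. F h = 0) \<longrightarrow> F g = 0}"

lemma flag_of_mult_borel:
  assumes g: "g \<in> carrier_mat n n" and b: "b \<in> borel_subgroup n"
  shows "flag_of n (g * b) = flag_of n g"
proof
  have as: "g * b * c = g * (b * c)" if "c \<in> borel_subgroup n" for c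
    using g b that by (intro square_mult_assoc[of _ n]) auto
  show "flag_of n (g * b) \<subseteq> flag_of n g"
    using b as by (auto simp: flag_of_def intro: borel_mult)
  obtain c where c: "c \<in> borel_subgroup n" "b * c = 1\<^sub>m n" using borel_inverse[OF b] .
  have "g * d = g * b * (c * d)" if d: "d \<in> borel_subgroup n" for d
  proof -
    have "g * d = g * ((b * c) * d)" unfolding c(2) using d by simp
    also have "(b * c) * d = b * (c * d)"
      using b c d by (intro square_mult_assoc[of _ n]) auto
    also have "g * \<dots> = g * b * (c * d)" using as borel_mult[OF c(1) d] by simp
    finally show ?thesis .
  qed
  then show "flag_of n g \<subseteq> flag_of n (g * b)"
    using borel_mult[OF c(1)] by (auto simp: flag_of_def)
qed

lemma flag_of_eqD:
  assumes g: "g \<in> carrier_mat n n" and eq: "flag_of n g = flag_of n h"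
  obtains b where "b \<in> borel_subgroup n" "g = h * b"
proof -
  have "g * 1\<^sub>m n \<in> flag_of n g" unfolding flag_of_def using one_borel by blast
  then have "g \<in> flag_of n h" using eq g by simp
  then show ?thesis using that unfolding flag_of_def by blast
qed

lemma perm_matrix_carrier [simp]: "perm_matrix n w \<in> carrier_mat n n"
  by (simp add: perm_matrix_def)

lemma perm_matrix_general_linear:
  assumes w: "w permutes {..<n}"
  shows "(perm_matrix n w :: 'k::field mat) \<in> general_linear n"
proof -
  have "(perm_matrix n w :: 'k mat) * perm_matrix n (inv_into UNIV w) = 1\<^sub>m n"
  proof (rule eq_matI)
    fix i j assume ij: "i < dim_row (1\<^sub>m n)" "j < dim_col (1\<^sub>m n)"
    then have k: "inv_into UNIV w j < n" using permutes_in_image[OF permutes_inv[OF w]] by auto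
    have "(\<Sum>l<n. perm_matrix n w $$ (i, l) * perm_matrix n (inv_into UNIV w) $$ (l, j)) =
        (perm_matrix n w $$ (i, inv_into UNIV w j) * perm_matrix n (inv_into UNIV w) $$ (inv_into UNIV w j, j) :: 'k)"
      using k ij by (intro sum_single_term) (auto simp: perm_matrix_def)
    then show "((perm_matrix n w :: 'k mat) * perm_matrix n (inv_into UNIV w)) $$ (i, j) = 1\<^sub>m n $$ (i, j)"
      using ij k permutes_inverses[OF w]
      by (subst mult_entry[of _ n n _ n]) (auto simp: perm_matrix_def)
  qed (auto simp: perm_matrix_def)
  from arg_cong[OF this, of det] show ?thesis
    using det_mult[of "perm_matrix n w :: 'k mat" n "perm_matrix n (inv_into UNIV w)"]
    by (auto simp: general_linear_iff)
qed

lemma double_coset_general_linear: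
  assumes "w permutes {..<n}"
  shows "double_coset n w \<subseteq> general_linear n"
  unfolding double_coset_def
  using general_linear_mult borel_general_linear perm_matrix_general_linear[OF assms] by blast

lemma double_coset_mult:
  assumes h: "h \<in> double_coset n w" and b: "b \<in> borel_subgroup n"
  shows "h * b \<in> double_coset n w" "b * h \<in> double_coset n w"
proof -
  obtain c c' where c: "c \<in> borel_subgroup n" "c' \<in> borel_subgroup n"
    "h = c * perm_matrix n w * c'"
    using h by (auto simp: double_coset_def)
  have 1: "h * b = c * perm_matrix n w * (c' * b)"
    unfolding c(3) using b c by (intro square_mult_assoc[of _ n]) auto
  have "b * h = b * (c * perm_matrix n w) * c'"
    unfolding c(3) using b c by (intro square_mult_assoc[of _ n, symmetric]) auto
  also have "b * (c * perm_matrix n w) = b * c * perm_matrix n w"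
    using b c by (intro square_mult_assoc[of _ n, symmetric]) auto
  finally show "h * b \<in> double_coset n w" "b * h \<in> double_coset n w"
    using 1 c(1,2) b borel_mult unfolding double_coset_def by blast+
qed

lemma schubert_cell_eq: "schubert_cell n w = flag_of n ` double_coset n w"
  by (auto simp: schubert_cell_def double_coset_def)

text \<open>
  The matrix \<open>G g\<close> in the proof writes \<open>b g c\<close> out entrywise, so that its entries are polynomial in
  \<open>g\<close> whatever the dimensions of \<open>g\<close> are.
\<close>

lemma poly_function_sandwich:
  fixes F :: "'k::field mat \<Rightarrow> 'k"
  assumes F: "F \<in> poly_functions ({..<n} \<times> {..<n})"
    and b: "b \<in> carrier_mat n n" and c: "c \<in> carrier_mat n n"
  obtains F' where "F' \<in> poly_functions ({..<n} \<times> {..<n})"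
    "\<And>g. g \<in> carrier_mat n n \<Longrightarrow> F' g = F (b * g * c)"
proof -
  let ?V = "{..<n} \<times> {..<n}"
  define G where "G g = mat n n (\<lambda>(i, j). \<Sum>k<n. (\<Sum>l<n. b $$ (i, l) * g $$ (l, k)) * c $$ (k, j))"
    for g :: "'k mat"
  have "(\<lambda>g. F (G g)) \<in> poly_functions ?V"
  proof (rule function_algebra_compose[OF function_algebra_poly_functions F])
    fix v assume "v \<in> ?V"
    then obtain i j where v: "v = (i, j)" "i < n" "j < n" by auto
    have "(\<lambda>g. \<Sum>k<n. (\<Sum>l<n. b $$ (i, l) * g $$ (l, k)) * c $$ (k, j)) \<in> poly_functions ?V"
      by (intro function_algebra_sum function_algebra_mult function_algebra_const
          function_algebra_poly_functions coordinate_poly_function) auto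
    then show "(\<lambda>g. G g $$ v) \<in> poly_functions ?V" using v by (simp add: G_def)
  qed
  moreover have "G g = b * g * c" if "g \<in> carrier_mat n n" for g
  proof (rule eq_matI)
    fix i j assume "i < dim_row (b * g * c)" "j < dim_col (b * g * c)"
    then have ij: "i < n" "j < n" using b c by auto
    have bg: "b * g \<in> carrier_mat n n" using b that by simp
    show "G g $$ (i, j) = (b * g * c) $$ (i, j)"
      using ij unfolding mult_entry[OF bg c ij]
      by (simp add: G_def mult_entry[OF b that])
  qed (use b c in \<open>auto simp: G_def\<close>)
  ultimately show ?thesis using that by metis
qed

text \<open>
  If \<open>F\<close> vanishes on \<open>B w B\<close>, then so does \<open>g \<mapsto> F (g b)\<close> for each \<open>b \<in> B\<close>.  The common zeros of
  all these functions form a closed set that is stable under right multiplication by \<open>B\<close>, hence the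
  preimage of a closed set of flags containing the Schubert cell.
\<close>

lemma schubert_variety_iff:
  fixes g :: "'k::field mat"
  assumes w: "w permutes {..<n}" and g: "g \<in> general_linear n"
  shows "flag_of n g \<in> schubert_variety n w \<longleftrightarrow> g \<in> schubert_preimage n w"
proof
  assume L: "flag_of n g \<in> schubert_variety n w"
  have "F g = 0" if F: "F \<in> poly_functions ({..<n} \<times> {..<n})"
    and F0: "\<forall>h\<in>double_coset n w. F h = 0" for F
  proof -
    \<comment> \<open>\<open>T\<close> is this set of common zeros, and \<open>P\<close> a family of polynomials that cuts it out.\<close>
    define T where "T = {h \<in> general_linear n. \<forall>b\<in>borel_subgroup n. F (h * b) = 0}"
    define P where "P = {p \<in> polys_in ({..<n} \<times> {..<n}).
      \<exists>b\<in>borel_subgroup n. \<forall>h\<in>carrier_mat n n. poly_value p h = F (h * b)}"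
    have "h \<in> T" if "h \<in> zero_locus (general_linear n) P" for h
    proof -
      have "F (h * b) = 0" if b: "b \<in> borel_subgroup n" for b
      proof -
        obtain F' where F': "F' \<in> poly_functions ({..<n} \<times> {..<n})"
          "\<And>g. g \<in> carrier_mat n n \<Longrightarrow> F' g = F (1\<^sub>m n * g * b)"
          using poly_function_sandwich[OF F one_carrier_mat borel_carrier[OF b]] by metis
        then obtain p where p: "p \<in> polys_in ({..<n} \<times> {..<n})" "F' = poly_value p"
          by (auto simp: poly_functions_def)
        then have "p \<in> P" using F' b by (auto simp: P_def)
        then show ?thesis
          using \<open>h \<in> zero_locus _ _\<close> p F' by (auto simp: zero_locus_def general_linear_carrier)
      qed
      then show ?thesis using that by (auto simp: T_def zero_locus_def)
    qed
    moreover have "T \<subseteq> zero_locus (general_linear n) P"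
      by (auto simp: T_def P_def zero_locus_def general_linear_carrier)
    ultimately have "T = zero_locus (general_linear n) P" by auto
    moreover have "P \<subseteq> polys_in ({..<n} \<times> {..<n})" by (auto simp: P_def)
    ultimately have T_closed: "closed_general_linear n T"
      unfolding closed_general_linear_def by (intro exI[of _ P] conjI)
    have "{h \<in> general_linear n. flag_of n h \<in> flag_of n ` T} = T"
    proof
      show "T \<subseteq> {h \<in> general_linear n. flag_of n h \<in> flag_of n ` T}" by (auto simp: T_def)
      show "{h \<in> general_linear n. flag_of n h \<in> flag_of n ` T} \<subseteq> T"
      proof clarify
        fix h h' assume h: "h \<in> general_linear n" "flag_of n h = flag_of n h'" "h' \<in> T"
        obtain c where c: "c \<in> borel_subgroup n" "h = h' * c"
          using flag_of_eqD[OF general_linear_carrier[OF h(1)] h(2)] .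
        have "h * b = h' * (c * b)" if "b \<in> borel_subgroup n" for b
          unfolding c(2) using h c that
          by (intro square_mult_assoc[of _ n]) (auto simp: T_def general_linear_carrier)
        then show "h \<in> T" using h borel_mult[OF c(1)] by (auto simp: T_def)
      qed
    qed
    moreover have "flag_of n ` T \<subseteq> flag_variety n" by (auto simp: T_def flag_variety_def)
    ultimately have "closed_flag n (flag_of n ` T)"
      using T_closed by (simp add: closed_flag_def)
    have "double_coset n w \<subseteq> T"
      using F0 double_coset_mult(1) subsetD[OF double_coset_general_linear[OF w]]
      unfolding T_def by blast
    then have "schubert_cell n w \<subseteq> flag_of n ` T"
      unfolding schubert_cell_eq by (rule image_mono)
    then have "schubert_variety n w \<subseteq> flag_of n ` T"
      unfolding schubert_variety_def using \<open>closed_flag n (flag_of n ` T)\<close> by (rule hull_minimal)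
    with L have "flag_of n g \<in> flag_of n ` T" by (rule subsetD[rotated])
    then obtain h where h: "flag_of n g = flag_of n h" "h \<in> T" by auto
    then obtain c where "c \<in> borel_subgroup n" "g = h * c"
      using flag_of_eqD[OF general_linear_carrier[OF g]] by metis
    then show "F g = 0" using h by (auto simp: T_def)
  qed
  then show "g \<in> schubert_preimage n w" using g by (auto simp: schubert_preimage_def)
next
  assume R: "g \<in> schubert_preimage n w"
  show "flag_of n g \<in> schubert_variety n w"
    unfolding schubert_variety_def hull_def
  proof (intro InterI, clarify)
    fix S :: "'k mat set set" assume S: "closed_flag n S" "schubert_cell n w \<subseteq> S"
    then obtain P where P: "P \<subseteq> polys_in ({..<n} \<times> {..<n})"
      "{g \<in> general_linear n. flag_of n g \<in> S} = zero_locus (general_linear n) P"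
      by (auto simp: closed_flag_def closed_general_linear_def)
    have "poly_value p g = 0" if "p \<in> P" for p
    proof -
      have "poly_value p h = 0" if h: "h \<in> double_coset n w" for h
      proof -
        have "h \<in> {g \<in> general_linear n. flag_of n g \<in> S}"
          using S h double_coset_general_linear[OF w] by (auto simp: schubert_cell_eq)
        then show ?thesis using P \<open>p \<in> P\<close> by (auto simp: zero_locus_def)
      qed
      moreover have "poly_value p \<in> poly_functions ({..<n} \<times> {..<n})"
        using P that by (auto simp: poly_functions_def)
      ultimately show ?thesis using R by (auto simp: schubert_preimage_def)
    qed
    then have "g \<in> zero_locus (general_linear n) P" using g by (auto simp: zero_locus_def)
    then show "flag_of n g \<in> S" using P by auto
  qed
qed

lemma Psi_flag_of:
  fixes X :: "'k::field mat"
  assumes X: "X \<in> strictly_lower n"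
  shows "Psi n (flag_of n (1\<^sub>m n + X)) = X"
  unfolding Psi_def
proof (rule the_equality)
  fix Y :: "'k mat"
  assume Y: "Y \<in> strictly_lower n \<and> flag_of n (1\<^sub>m n + X) = flag_of n (1\<^sub>m n + Y)"
  have c: "X \<in> carrier_mat n n" "Y \<in> carrier_mat n n"
    using X Y by (auto simp: strictly_lower_def)
  obtain b where "b \<in> borel_subgroup n" "1\<^sub>m n + X = (1\<^sub>m n + Y) * b"
    using flag_of_eqD[of "1\<^sub>m n + X" n "1\<^sub>m n + Y"] Y c by auto
  then have "1\<^sub>m n + X = 1\<^sub>m n + Y"
    using lower_unitriangular_borel_unique strictly_lower_add_one[OF X]
      strictly_lower_add_one[OF conjunct1[OF Y]] by metis
  show "Y = X"
  proof (rule eq_matI)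
    fix i j assume "i < dim_row X" "j < dim_col X"
    then show "Y $$ (i, j) = X $$ (i, j)"
      using arg_cong[OF \<open>1\<^sub>m n + X = 1\<^sub>m n + Y\<close>, of "\<lambda>M. M $$ (i, j)"] c by auto
  qed (use c in auto)
qed (use X in auto)

lemma schubert_chart_eq:
  fixes w :: "nat \<Rightarrow> nat"
  assumes w: "w permutes {..<n}"
  shows "schubert_chart n w =
    {X \<in> strictly_lower n. 1\<^sub>m n + X \<in> (schubert_preimage n w :: 'k::field mat set)}"
proof -
  have main: "main_nbhd n = (\<lambda>X :: 'k mat. flag_of n (1\<^sub>m n + X)) ` strictly_lower n"
  proof -
    have "flag_of n (u * b) \<in> (\<lambda>X. flag_of n (1\<^sub>m n + X)) ` strictly_lower n"
      if "u \<in> lower_unitriangular n" "b \<in> borel_subgroup n" for u b :: "'k mat"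
      using that lower_unitriangular_minus_one[OF that(1)] flag_of_mult_borel[of u n b]
      by (intro image_eqI[of _ _ "u - 1\<^sub>m n"]) (auto simp: lower_unitriangular_def)
    moreover have "flag_of n (1\<^sub>m n + X) \<in> main_nbhd n" if X: "X \<in> strictly_lower n" for X :: "'k mat"
    proof -
      have "1\<^sub>m n + X \<in> carrier_mat n n" using X by (simp add: strictly_lower_def)
      then show ?thesis
        unfolding main_nbhd_def using strictly_lower_add_one[OF X]
        by (intro CollectI exI[of _ "1\<^sub>m n + X"] exI[of _ "1\<^sub>m n"]) simp
    qed
    ultimately show ?thesis by (auto simp: main_nbhd_def)
  qed
  have *: "flag_of n (1\<^sub>m n + X) \<in> schubert_variety n w \<longleftrightarrow> 1\<^sub>m n + X \<in> schubert_preimage n w"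
    if "X \<in> strictly_lower n" for X :: "'k mat"
    using that by (intro schubert_variety_iff w lower_unitriangular_general_linear
        strictly_lower_add_one)
  show ?thesis
    unfolding schubert_chart_def main
  proof (intro Set.set_eqI iffI)
    fix X :: "'k mat"
    assume "X \<in> Psi n ` (schubert_variety n w \<inter> (\<lambda>X. flag_of n (1\<^sub>m n + X)) ` strictly_lower n)"
    then obtain Y :: "'k mat" where "Y \<in> strictly_lower n" "X = Psi n (flag_of n (1\<^sub>m n + Y))"
      "flag_of n (1\<^sub>m n + Y) \<in> schubert_variety n w" by auto
    then show "X \<in> {X \<in> strictly_lower n. 1\<^sub>m n + X \<in> schubert_preimage n w}"
      using * Psi_flag_of[of Y n] by simp
  next
    fix X :: "'k mat" assume "X \<in> {X \<in> strictly_lower n. 1\<^sub>m n + X \<in> schubert_preimage n w}"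
    then show "X \<in> Psi n ` (schubert_variety n w \<inter> (\<lambda>X. flag_of n (1\<^sub>m n + X)) ` strictly_lower n)"
      using * Psi_flag_of[of X n] by (intro image_eqI[of _ _ "flag_of n (1\<^sub>m n + X)"]) auto
  qed
qed

text \<open>
  In the chart, functions of \<open>1 + X\<close> become polynomials in the entries below the diagonal alone.
\<close>

lemma poly_function_shift:
  fixes F :: "'k::field mat \<Rightarrow> 'k"
  assumes F: "F \<in> poly_functions ({..<n} \<times> {..<n})"
  obtains F' where "F' \<in> poly_functions (pos_roots n)"
    "\<And>X. X \<in> strictly_lower n \<Longrightarrow> F' X = F (1\<^sub>m n + X)"
proof -
  define G where "G X = mat n n (\<lambda>(i, j). if j < i then X $$ (i, j) else if i = j then 1 else 0)"
    for X :: "'k mat"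
  have "(\<lambda>X. F (G X)) \<in> poly_functions (pos_roots n)"
  proof (rule function_algebra_compose[OF function_algebra_poly_functions F])
    fix v :: "nat \<times> nat" assume "v \<in> {..<n} \<times> {..<n}"
    then obtain i j where v: "v = (i, j)" "i < n" "j < n" by auto
    show "(\<lambda>X. G X $$ v) \<in> poly_functions (pos_roots n)"
      using v coordinate_poly_function[of v "pos_roots n"]
        function_algebra_const[OF function_algebra_poly_functions]
      by (cases "j < i"; cases "i = j") (auto simp: G_def pos_roots_def)
  qed
  moreover have "G X = 1\<^sub>m n + X" if "X \<in> strictly_lower n" for X
    using that by (intro eq_matI) (auto simp: G_def strictly_lower_def)
  ultimately show ?thesis using that by metis
qed

section \<open>Density of the Schubert cell in the chart\<close>

definition chart_cell :: "nat \<Rightarrow> (nat \<Rightarrow> nat) \<Rightarrow> 'k::field mat set" where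
  "chart_cell n w = {X \<in> strictly_lower n. 1\<^sub>m n + X \<in> double_coset n w}"

text \<open>
  The functions \<open>f\<close> that become members of \<open>A\<close> after multiplication by a power of the denominator
  \<open>d\<close>; only the values at points with \<open>d \<noteq> 0\<close> matter.  They again form an algebra, which is what
  makes clearing denominators in a composite polynomial expression automatic.
\<close>

definition fractions :: "('a \<Rightarrow> 'k::field) set \<Rightarrow> ('a \<Rightarrow> 'k) \<Rightarrow> ('a \<Rightarrow> 'k) set" where
  "fractions A d = {f. \<exists>N. \<exists>H\<in>A. \<forall>x. d x \<noteq> 0 \<longrightarrow> d x ^ N * f x = H x}"

lemma fractionsI: "H \<in> A \<Longrightarrow> (\<And>x. d x \<noteq> 0 \<Longrightarrow> d x ^ N * f x = H x) \<Longrightarrow> f \<in> fractions A d"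
  by (auto simp: fractions_def)

lemma fractions_superset: "A \<subseteq> fractions A d"
  by (auto intro: fractionsI[of _ _ _ 0])

lemma function_algebra_fractions:
  assumes A: "function_algebra A" and d: "d \<in> A"
  shows "function_algebra (fractions A d)"
proof -
  note A_intros = function_algebra_add[OF A] function_algebra_mult[OF A]
    function_algebra_power[OF A d]
  have "(\<lambda>x. f x + g x) \<in> fractions A d \<and> (\<lambda>x. f x * g x) \<in> fractions A d"
    if "f \<in> fractions A d" "g \<in> fractions A d" for f g
  proof -
    obtain M F where F: "F \<in> A" "\<And>x. d x \<noteq> 0 \<Longrightarrow> d x ^ M * f x = F x"
      using \<open>f \<in> _\<close> by (auto simp: fractions_def)
    obtain N G where G: "G \<in> A" "\<And>x. d x \<noteq> 0 \<Longrightarrow> d x ^ N * g x = G x"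
      using \<open>g \<in> _\<close> by (auto simp: fractions_def)
    have "(\<lambda>x. f x + g x) \<in> fractions A d"
    proof (rule fractionsI[of _ _ _ "M + N"])
      show "(\<lambda>x. d x ^ N * F x + d x ^ M * G x) \<in> A" by (intro A_intros F G)
      show "d x ^ (M + N) * (f x + g x) = d x ^ N * F x + d x ^ M * G x" if "d x \<noteq> 0" for x
        using F(2)[OF that, symmetric] G(2)[OF that, symmetric]
        by (simp add: power_add algebra_simps)
    qed
    moreover have "(\<lambda>x. f x * g x) \<in> fractions A d"
    proof (rule fractionsI[of _ _ _ "M + N"])
      show "(\<lambda>x. F x * G x) \<in> A" by (intro A_intros F G)
      show "d x ^ (M + N) * (f x * g x) = F x * G x" if "d x \<noteq> 0" for x
        using F(2)[OF that, symmetric] G(2)[OF that, symmetric]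
        by (simp add: power_add algebra_simps)
    qed
    ultimately show ?thesis ..
  qed
  moreover have "(\<lambda>_. c) \<in> fractions A d" for c
    using fractions_superset function_algebra_const[OF A] by (rule subsetD)
  ultimately show ?thesis unfolding function_algebra_def by blast
qed

definition leading_block :: "nat \<Rightarrow> 'k mat \<Rightarrow> 'k mat" where
  "leading_block k g = mat k k (\<lambda>(i, j). g $$ (i, j))"

definition leading_minors :: "nat \<Rightarrow> 'k::field mat \<Rightarrow> 'k" where
  "leading_minors n g = (\<Prod>j<n. det (leading_block (Suc j) g))"

text \<open>
  The upper triangular matrix that turns \<open>g\<close> into its lower unitriangular factor by right
  multiplication.  Column \<open>j\<close> has to combine the columns \<open>0, \<dots>, j\<close> of \<open>g\<close> so that the first
  \<open>j + 1\<close> entries become those of the unit vector \<open>e\<^sub>j\<close>; by Cramer's rule the coefficients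
  are the last column of the adjugate of the leading block of size \<open>j + 1\<close>, divided by its
  determinant.
\<close>

definition lower_reduction :: "nat \<Rightarrow> 'k::field mat \<Rightarrow> 'k mat" where
  "lower_reduction n g = mat n n (\<lambda>(k, j). if k \<le> j
     then adj_mat (leading_block (Suc j) g) $$ (k, j) * (1 / det (leading_block (Suc j) g)) else 0)"

lemma leading_block_carrier [simp]: "leading_block k g \<in> carrier_mat k k"
  by (simp add: leading_block_def)

lemma lower_reduction_carrier [simp]: "lower_reduction n g \<in> carrier_mat n n"
  by (simp add: lower_reduction_def)

lemma lower_reduction_dim [simp]:
  "dim_row (lower_reduction n g) = n" "dim_col (lower_reduction n g) = n"
  by (simp_all add: lower_reduction_def)

lemma lower_reduction_lower_unitriangular:
  fixes g :: "'k::field mat"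
  assumes g: "g \<in> carrier_mat n n" and d: "leading_minors n g \<noteq> 0"
  shows "g * lower_reduction n g \<in> lower_unitriangular n"
proof -
  have "(g * lower_reduction n g) $$ (i, j) = (if i = j then 1 else 0)" if ij: "i \<le> j" "j < n" for i j
  proof -
    let ?B = "leading_block (Suc j) g"
    have dj: "det ?B \<noteq> 0" using d ij by (auto simp: leading_minors_def)
    have aB: "adj_mat ?B \<in> carrier_mat (Suc j) (Suc j)" using adj_mat(1)[of ?B "Suc j"] by simp
    have "(g * lower_reduction n g) $$ (i, j) =
        (\<Sum>k<n. g $$ (i, k) * lower_reduction n g $$ (k, j))"
      using g ij by (intro mult_entry) auto
    also have "\<dots> = (\<Sum>k<Suc j. g $$ (i, k) * lower_reduction n g $$ (k, j))"
      using ij by (intro sum.mono_neutral_right) (auto simp: lower_reduction_def)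
    also have "\<dots> = (\<Sum>k<Suc j. ?B $$ (i, k) * adj_mat ?B $$ (k, j)) * (1 / det ?B)"
      unfolding sum_distrib_right
      using ij by (intro sum.cong) (auto simp: lower_reduction_def leading_block_def)
    also have "(\<Sum>k<Suc j. ?B $$ (i, k) * adj_mat ?B $$ (k, j)) = (?B * adj_mat ?B) $$ (i, j)"
      using ij aB by (intro mult_entry[of _ "Suc j" "Suc j" _ "Suc j", symmetric]) auto
    also have "?B * adj_mat ?B = det ?B \<cdot>\<^sub>m 1\<^sub>m (Suc j)" by (rule adj_mat) simp
    finally show ?thesis using ij dj by auto
  qed
  then show ?thesis using g by (auto simp: lower_unitriangular_def simp del: index_mult_mat(1))
qed

lemma lower_reduction_borel:
  fixes g :: "'k::field mat"
  assumes g: "g \<in> carrier_mat n n" and d: "leading_minors n g \<noteq> 0"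
  shows "lower_reduction n g \<in> borel_subgroup n"
proof -
  have "det g * det (lower_reduction n g) = 1"
    using lower_unitriangular_det[OF lower_reduction_lower_unitriangular[OF g d]]
      det_mult[OF g lower_reduction_carrier] by simp
  then have "lower_reduction n g \<in> general_linear n" by (auto simp: general_linear_iff)
  moreover have "upper_triangular (lower_reduction n g)"
    by (auto simp: upper_triangular_def lower_reduction_def)
  ultimately show ?thesis by (simp add: borel_subgroup_def)
qed

lemma leading_minors_lower_unitriangular:
  assumes "L \<in> lower_unitriangular n"
  shows "leading_minors n L = 1"
proof -
  have "leading_block (Suc j) L \<in> lower_unitriangular (Suc j)" if "j < n" for j
    using assms that by (auto simp: leading_block_def lower_unitriangular_def)
  then show ?thesis
    unfolding leading_minors_def by (intro prod.neutral) (auto dest: lower_unitriangular_det)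
qed

lemma leading_block_det_poly_function:
  assumes "k \<le> n"
  shows "(\<lambda>g :: 'k::field mat. det (leading_block k g)) \<in> poly_functions ({..<n} \<times> {..<n})"
proof (rule function_algebra_det[OF function_algebra_poly_functions leading_block_carrier])
  fix i j assume "i < k" "j < k"
  then show "(\<lambda>g. leading_block k g $$ (i, j)) \<in> poly_functions ({..<n} \<times> {..<n})"
    using assms coordinate_poly_function[of "(i, j)" "{..<n} \<times> {..<n}"]
    by (auto simp: leading_block_def)
qed

lemma leading_block_adj_poly_function:
  assumes "k \<le> n" and ij: "i < k" "j < k"
  shows "(\<lambda>g :: 'k::field mat. adj_mat (leading_block k g) $$ (i, j)) \<in> poly_functions ({..<n} \<times> {..<n})"
proof -
  let ?V = "{..<n} \<times> {..<n}"
  have "(\<lambda>g :: 'k mat. det (mat_delete (leading_block k g) j i)) \<in> poly_functions ?V"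
  proof (rule function_algebra_det[OF function_algebra_poly_functions, of _ "k - 1"])
    show "mat_delete (leading_block k g) j i \<in> carrier_mat (k - 1) (k - 1)" for g :: "'k mat"
      by (rule mat_delete_carrier) simp
    fix i' j' assume "i' < k - 1" "j' < k - 1"
    then show "(\<lambda>g :: 'k mat. mat_delete (leading_block k g) j i $$ (i', j')) \<in> poly_functions ?V"
      using assms
      by (auto simp: mat_delete_def leading_block_def intro!: coordinate_poly_function)
  qed
  then have "(\<lambda>g :: 'k mat. (- 1) ^ (j + i) * det (mat_delete (leading_block k g) j i)) \<in> poly_functions ?V"
    by (intro function_algebra_mult function_algebra_const function_algebra_poly_functions)
  then show ?thesis using ij by (simp add: adj_mat_def cofactor_def leading_block_def)
qed

text \<open>
  The big cell is the open set where no leading minor vanishes, and there the chart is given by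
  quotients of polynomials, with denominators that divide a power of the product \<open>d\<close> of the leading
  minors.  If \<open>F\<close> vanishes on \<open>A\<^sub>w\<close>, then a polynomial multiple of \<open>F \<circ> \<Psi>\<close> that also vanishes where
  \<open>d = 0\<close> is a polynomial vanishing on all of \<open>B w B\<close>.  It therefore vanishes on the preimage of the
  Schubert variety, and at \<open>1 + X\<close> the leading minors are \<open>1\<close>, so \<open>F X\<close> can be read off.
\<close>

theorem chart_cell_dense:
  fixes F :: "'k::field mat \<Rightarrow> 'k"
  assumes w: "w permutes {..<n}" and F: "F \<in> poly_functions ({..<n} \<times> {..<n})"
    and F0: "\<And>X. X \<in> chart_cell n w \<Longrightarrow> F X = 0"
    and X: "X \<in> schubert_chart n w"
  shows "F X = 0"
proof -
  let ?V = "{..<n} \<times> {..<n}"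
  let ?A = "poly_functions ?V :: ('k mat \<Rightarrow> 'k) set"
  let ?d = "leading_minors n :: 'k mat \<Rightarrow> 'k"
  note A = function_algebra_poly_functions[of ?V, where ?'k='k]
  define M :: "'k mat \<Rightarrow> 'k mat" where "M g = mat n n (\<lambda>(i, j).
      (\<Sum>k<n. g $$ (i, k) * lower_reduction n g $$ (k, j)) + (if i = j then -1 else 0))" for g
  have dA: "?d \<in> ?A"
    unfolding leading_minors_def
    by (intro function_algebra_prod A leading_block_det_poly_function) auto
  note Q = function_algebra_fractions[OF A dA]
  have "(\<lambda>g. F (M g)) \<in> fractions ?A ?d"
  proof (rule function_algebra_compose[OF Q F])
    fix v assume "v \<in> ?V"
    then obtain i j where v: "v = (i, j)" "i < n" "j < n" by auto
    have inv: "(\<lambda>g. 1 / det (leading_block (Suc j) g)) \<in> fractions ?A ?d"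
    proof (rule fractionsI[of _ _ _ 1])
      show "(\<lambda>g. \<Prod>l\<in>{..<n} - {j}. det (leading_block (Suc l) g)) \<in> ?A"
        by (intro function_algebra_prod A leading_block_det_poly_function) auto
      show "?d g ^ 1 * (1 / det (leading_block (Suc j) g)) =
          (\<Prod>l\<in>{..<n} - {j}. det (leading_block (Suc l) g))" if "?d g \<noteq> 0" for g
      proof -
        have "?d g = det (leading_block (Suc j) g) * (\<Prod>l\<in>{..<n} - {j}. det (leading_block (Suc l) g))"
          unfolding leading_minors_def using v by (intro prod.remove) auto
        then show ?thesis using that by auto
      qed
    qed
    have red: "(\<lambda>g. lower_reduction n g $$ (k, j)) \<in> fractions ?A ?d" if "k < n" for k
    proof (cases "k \<le> j")
      case True
      have "(\<lambda>g. adj_mat (leading_block (Suc j) g) $$ (k, j)) \<in> fractions ?A ?d"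
        using True v by (intro subsetD[OF fractions_superset] leading_block_adj_poly_function) auto
      from function_algebra_mult[OF Q this inv] show ?thesis
        using True that v by (simp add: lower_reduction_def)
    next
      case False
      then show ?thesis
        using that v function_algebra_const[OF Q, of 0] by (simp add: lower_reduction_def)
    qed
    have "(\<lambda>g. (\<Sum>k<n. g $$ (i, k) * lower_reduction n g $$ (k, j)) + (if i = j then -1 else 0))
        \<in> fractions ?A ?d"
      using v by (intro function_algebra_add function_algebra_sum function_algebra_mult Q red
          subsetD[OF fractions_superset coordinate_poly_function] function_algebra_const[OF Q]) auto
    then show "(\<lambda>g. M g $$ v) \<in> fractions ?A ?d" using v by (simp add: M_def)
  qed
  then obtain N H where H: "H \<in> ?A" "\<And>g. ?d g \<noteq> 0 \<Longrightarrow> ?d g ^ N * F (M g) = H g"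
    unfolding fractions_def by auto
  have M: "1\<^sub>m n + M g = g * lower_reduction n g" if g: "g \<in> carrier_mat n n" for g
    using g by (intro eq_matI)
      (auto simp: M_def mult_entry[OF g lower_reduction_carrier] simp del: index_mult_mat(1))
  \<comment> \<open>The factor \<open>?d h\<close> takes care of the points outside the big cell.\<close>
  have G0: "?d h * H h = 0" if h: "h \<in> double_coset n w" for h
  proof (cases "?d h = 0")
    case False
    have hc: "h \<in> carrier_mat n n"
      using h double_coset_general_linear[OF w] general_linear_carrier by blast
    let ?L = "h * lower_reduction n h"
    have "?L \<in> lower_unitriangular n" by (rule lower_reduction_lower_unitriangular[OF hc False])
    then have "1\<^sub>m n + M h \<in> lower_unitriangular n" by (simp only: M[OF hc])
    then have "M h \<in> strictly_lower n"
      unfolding strictly_lower_def lower_unitriangular_def by (auto simp: M_def)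
    moreover have "?L \<in> double_coset n w"
      using double_coset_mult(1)[OF h lower_reduction_borel[OF hc False]] .
    then have "1\<^sub>m n + M h \<in> double_coset n w" by (simp only: M[OF hc])
    ultimately have "F (M h) = 0" by (intro F0) (simp add: chart_cell_def)
    then show ?thesis using H(2)[OF False] by simp
  qed simp
  have GA: "(\<lambda>h. ?d h * H h) \<in> ?A" by (intro function_algebra_mult A dA H)
  have XS: "X \<in> strictly_lower n" "1\<^sub>m n + X \<in> schubert_preimage n w"
    using X schubert_chart_eq[OF w] by auto
  have "\<forall>F\<in>?A. (\<forall>h\<in>double_coset n w. F h = 0) \<longrightarrow> F (1\<^sub>m n + X) = 0"
    using XS(2) by (simp add: schubert_preimage_def)
  from bspec[OF this GA] G0 have "?d (1\<^sub>m n + X) * H (1\<^sub>m n + X) = 0" by simp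
  moreover have L: "1\<^sub>m n + X \<in> lower_unitriangular n" by (rule strictly_lower_add_one[OF XS(1)])
  then have d1: "?d (1\<^sub>m n + X) = 1" by (rule leading_minors_lower_unitriangular)
  ultimately have "F (M (1\<^sub>m n + X)) = 0" using H(2)[of "1\<^sub>m n + X"] by simp
  moreover have "M (1\<^sub>m n + X) = X"
  proof -
    have c: "1\<^sub>m n + X \<in> carrier_mat n n" using XS by (simp add: strictly_lower_def)
    have "1\<^sub>m n + M (1\<^sub>m n + X) = 1\<^sub>m n + X"
      unfolding M[OF c] using c d1
      by (intro lower_unitriangular_borel_unique[OF L lower_reduction_lower_unitriangular[OF c]
            lower_reduction_borel[OF c]]) auto
    from arg_cong[OF this, of "\<lambda>M. M - 1\<^sub>m n"] show ?thesis
      using XS by (intro eq_matI) (auto simp: M_def strictly_lower_def mat_eq_iff)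
  qed
  ultimately show ?thesis by simp
qed

section \<open>Degenerations between Bruhat cells\<close>

lemma schubert_preimage_mono:
  assumes "double_coset n v \<subseteq> (schubert_preimage n w :: 'k::field mat set)"
  shows "schubert_preimage n v \<subseteq> (schubert_preimage n w :: 'k mat set)"
proof
  fix g :: "'k mat" assume g: "g \<in> schubert_preimage n v"
  have "F g = 0" if F: "F \<in> poly_functions ({..<n} \<times> {..<n})" and F0: "\<forall>h\<in>double_coset n w. F h = 0" for F
  proof -
    have "F h = 0" if "h \<in> double_coset n v" for h
      using subsetD[OF assms that] F F0 by (simp add: schubert_preimage_def)
    then show ?thesis using g F by (simp add: schubert_preimage_def)
  qed
  then show "g \<in> schubert_preimage n w" using g by (simp add: schubert_preimage_def)
qed

lemma double_coset_subset_preimage: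
  assumes "v permutes {..<n}"
  shows "double_coset n v \<subseteq> schubert_preimage n v"
  using double_coset_general_linear[OF assms] by (auto simp: schubert_preimage_def)

lemma mult_perm_matrix_entry:
  fixes M :: "'k::field mat"
  assumes M: "M \<in> carrier_mat n n" and w: "w permutes {..<n}" and ij: "i < n" "j < n"
  shows "(M * perm_matrix n w) $$ (i, j) = M $$ (i, w j)"
proof -
  have "(M * perm_matrix n w) $$ (i, j) = (\<Sum>l<n. M $$ (i, l) * perm_matrix n w $$ (l, j))"
    using M ij by (intro mult_entry) auto
  also have "\<dots> = M $$ (i, w j) * perm_matrix n w $$ (w j, j)"
    using ij permutes_in_image[OF w, of j] by (intro sum_single_term) (auto simp: perm_matrix_def)
  finally show ?thesis using ij permutes_in_image[OF w, of j] by (simp add: perm_matrix_def)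
qed

lemma sum_two_terms:
  fixes f :: "nat \<Rightarrow> 'k::comm_semiring_1"
  assumes "r < n" "i < n"
  shows "(\<Sum>l<n. ((if l = r then d else 0) + (if l = i then e else 0)) * f l) = d * f r + e * f i"
proof -
  have "(\<Sum>l<n. ((if l = r then d else 0) + (if l = i then e else 0)) * f l) =
      (\<Sum>l<n. if l = r then d * f l else 0) + (\<Sum>l<n. if l = i then e * f l else 0)"
    unfolding sum.distrib[symmetric] by (intro sum.cong) (auto simp: algebra_simps)
  then show ?thesis using assms by (simp add: sum.delta')
qed

text \<open>
  One covering step of the Bruhat order.  Adding \<open>t\<close> at the place \<open>(v b, a)\<close>, which lies in the
  column of the first and in the row of the second of two ascending ones of \<open>v\<close>, gives a curve that
  starts at \<open>v\<close>.  For \<open>t \<noteq> 0\<close> the new entry serves as a pivot: one row operation and one column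
  operation in \<open>B\<close> remove the old ones and leave the permutation matrix with the two values
  exchanged, up to a diagonal matrix.  The matrices \<open>u\<close> and \<open>u'\<close> of the proof undo these steps.
\<close>

lemma transpose_degeneration:
  assumes v: "v permutes {..<n}" and ab: "a < b" "b < n" "v a < v b"
  shows "double_coset n v \<subseteq> (schubert_preimage n (v \<circ> Transposition.transpose a b) :: 'k::field_char_0 mat set)"
proof
  let ?v = "v \<circ> Transposition.transpose a b"
  let ?V = "{..<n} \<times> {..<n}"
  have vn: "v j < n" if "j < n" for j using permutes_in_image[OF v, of j] that by auto
  have tr: "Transposition.transpose a b permutes {..<n}" using ab by (intro permutes_swap_id) auto
  have v': "?v permutes {..<n}" using tr v by (rule permutes_compose)
  have inj: "v i = v j \<longleftrightarrow> i = j" for i j using permutes_inj[OF v] by (auto dest: injD)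
  fix h :: "'k mat" assume h: "h \<in> double_coset n v"
  then obtain c c' where c: "c \<in> borel_subgroup n" "c' \<in> borel_subgroup n"
    "h = c * perm_matrix n v * c'"
    by (auto simp: double_coset_def)
  define M :: "'k \<Rightarrow> 'k mat" where
    "M t = mat n n (\<lambda>(i, j). if i = v j then 1 else if i = v b \<and> j = a then t else 0)" for t
  have M0: "M 0 = perm_matrix n v" by (auto simp: M_def perm_matrix_def intro!: eq_matI)
  have Mt: "M t \<in> double_coset n ?v" if t: "t \<noteq> 0" for t
  proof -
    define u :: "'k mat" where
      "u = mat n n (\<lambda>(i, j). if i = j then 1 else if i = v a \<and> j = v b then 1 / t else 0)"
    define \<tau> where "\<tau> j = (if j = a then t else if j = b then - 1 / t else 1)" for j
    define u' :: "'k mat" where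
      "u' = mat n n (\<lambda>(k, j). (if k = j then \<tau> j else 0) + (if k = a then (if j = b then 1 else 0) else 0))"
    have u: "u \<in> borel_subgroup n" "u' \<in> borel_subgroup n"
      using ab t unfolding borel_iff by (auto simp: u_def u'_def \<tau>_def upper_triangular_def)
    have uv: "(u * perm_matrix n ?v) $$ (i, j) = u $$ (i, ?v j)" if "i < n" "j < n" for i j
      using that u v' by (intro mult_perm_matrix_entry) auto
    have "M t = u * perm_matrix n ?v * u'"
    proof (rule eq_matI)
      fix i j assume "i < dim_row (u * perm_matrix n ?v * u')" "j < dim_col (u * perm_matrix n ?v * u')"
      then have ij: "i < n" "j < n" by (auto simp: u_def u'_def)
      have "(u * perm_matrix n ?v * u') $$ (i, j) =
          (\<Sum>k<n. (u * perm_matrix n ?v) $$ (i, k) * u' $$ (k, j))"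
        using u ij by (intro mult_entry) auto
      also have "\<dots> = (\<Sum>k<n. ((if k = j then \<tau> j else 0) + (if k = a then (if j = b then 1 else 0) else 0))
          * u $$ (i, ?v k))"
        using ij by (intro sum.cong refl, subst uv) (auto simp: u'_def)
      also have "\<dots> = \<tau> j * u $$ (i, ?v j) + (if j = b then 1 else 0) * u $$ (i, ?v a)"
        using ij ab by (intro sum_two_terms) auto
      also have "\<dots> = M t $$ (i, j)"
      proof -
        have n: "v a < n" "v b < n" "v j < n" "v a \<noteq> v b" "a \<noteq> b" using vn ij ab by auto
        consider "j = a" | "j = b" | "j \<noteq> a" "j \<noteq> b" by blast
        then show ?thesis
        proof cases
          case 3
          then have "v j \<noteq> v b" "?v j = v j" by (simp_all add: inj)
          then show ?thesis using 3 n ij by (simp add: M_def u_def \<tau>_def)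
        qed (use n ij t in \<open>simp_all add: M_def u_def \<tau>_def\<close>)
      qed
      finally show "M t $$ (i, j) = (u * perm_matrix n ?v * u') $$ (i, j)" by simp
    qed (auto simp: M_def u_def u'_def)
    then show ?thesis using u by (auto simp: double_coset_def)
  qed
  have "F h = 0" if F: "F \<in> poly_functions ?V" and F0: "\<forall>g\<in>double_coset n ?v. F g = 0" for F
  proof -
    obtain F' where F': "F' \<in> poly_functions ?V"
      "\<And>g. g \<in> carrier_mat n n \<Longrightarrow> F' g = F (c * g * c')"
      using poly_function_sandwich[OF F borel_carrier[OF c(1)] borel_carrier[OF c(2)]] by metis
    have "(\<lambda>t. F' (M t)) \<in> range poly"
    proof (rule function_algebra_compose[OF function_algebra_poly F'(1)])
      fix x assume "x \<in> ?V"
      then obtain i j where x: "x = (i, j)" "i < n" "j < n" by auto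
      have "(\<lambda>_. c) \<in> range (poly :: 'k poly \<Rightarrow> _)" for c
        by (rule function_algebra_const[OF function_algebra_poly])
      from this[of 0] this[of 1] poly_function_id
      have "(\<lambda>t. if i = v j then 1 else if i = v b \<and> j = a then t else 0) \<in> range (poly :: 'k poly \<Rightarrow> _)"
        by (cases "i = v j"; cases "i = v b \<and> j = a") (simp_all only: if_True if_False simp_thms)
      then show "(\<lambda>t. M t $$ x) \<in> range poly" using x by (simp add: M_def)
    qed
    moreover have "F' (M t) = 0" if "t \<noteq> 0" for t
    proof -
      have "c * M t * c' \<in> double_coset n ?v"
        using double_coset_mult(1)[OF double_coset_mult(2)[OF Mt[OF that] c(1)] c(2)] .
      then show ?thesis using F'(2)[of "M t"] F0 by (auto simp: M_def)
    qed
    ultimately have "F' (M 0) = 0" by (rule poly_function_eq_0)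
    then show ?thesis using F'(2)[of "M 0"] c(3) by (simp add: M0)
  qed
  then show "h \<in> schubert_preimage n ?v"
    using h double_coset_general_linear[OF v] by (auto simp: schubert_preimage_def)
qed

text \<open>
  By the rearrangement inequality this sum measures how far \<open>v\<close> is from decreasing; it serves as
  termination measure for chains of exchanges in both directions.
\<close>

lemma sum_mult_transpose_less:
  fixes v :: "nat \<Rightarrow> nat"
  assumes ab: "a < b" "b < n" "v a < v b"
  shows "(\<Sum>j<n. j * (v \<circ> Transposition.transpose a b) j) < (\<Sum>j<n. j * v j)"
proof -
  have split: "(\<Sum>j<n. f j) = f a + f b + (\<Sum>j\<in>{..<n} - {a} - {b}. f j)" for f :: "nat \<Rightarrow> nat"
  proof -
    have "(\<Sum>j<n. f j) = f a + sum f ({..<n} - {a})" using ab by (intro sum.remove) auto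
    also have "sum f ({..<n} - {a}) = f b + sum f ({..<n} - {a} - {b})"
      using ab by (intro sum.remove) auto
    finally show ?thesis by simp
  qed
  obtain d e where "b = a + d" "v b = v a + e" "d > 0" "e > 0"
    using ab by (metis less_imp_add_positive)
  then have "a * v b + b * v a < a * v a + b * v b" by (simp add: algebra_simps)
  moreover have "(\<Sum>j\<in>{..<n} - {a} - {b}. j * (v \<circ> Transposition.transpose a b) j) =
      (\<Sum>j\<in>{..<n} - {a} - {b}. j * v j)"
    by (intro sum.cong) (auto simp: Transposition.transpose_def)
  ultimately show ?thesis
    unfolding split[of "\<lambda>j. j * v j"] split[of "\<lambda>j. j * (v \<circ> Transposition.transpose a b) j"]
    by simp
qed

lemma mono_permutation_eq_id:
  assumes v: "v permutes {..<n :: nat}" and mono: "\<And>a b. a < b \<Longrightarrow> b < n \<Longrightarrow> v a < v b"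
  shows "v = id"
proof
  fix j
  show "v j = id j"
  proof (cases "j < n")
    case True
    then show ?thesis
    proof (induction j rule: less_induct)
      case (less j)
      obtain k where k: "v k = j" using permutes_surj[OF v] by (metis surjD)
      then have kn: "k < n" using less.prems permutes_in_image[OF v, of k] by auto
      have "\<not> k < j" using less.IH[of k] kn k by auto
      moreover have "\<not> j < k"
      proof
        assume "j < k"
        then have "v j < j" using mono[of j k] kn k by simp
        then have "v (v j) = v j" using less by simp
        from injD[OF permutes_inj[OF v] this] show False using \<open>v j < j\<close> by simp
      qed
      ultimately show ?case using k by (simp add: not_less)
    qed
  qed (use permutes_not_in[OF v] in auto)
qed

text \<open>
  The identity is the least permutation: exchanging the values of an inversion moves down in the
  Bruhat order, and the bound \<open>n * n * n\<close> on the sum stops the process.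
\<close>

lemma identity_degeneration:
  assumes v: "v permutes {..<n}"
  shows "double_coset n id \<subseteq> (schubert_preimage n v :: 'k::field_char_0 mat set)"
  using v
proof (induction "n * n * n - (\<Sum>j<n. j * v j)" arbitrary: v rule: less_induct)
  case less
  note v = \<open>v permutes {..<n}\<close>
  show ?case
  proof (cases "\<exists>a b. a < b \<and> b < n \<and> v b < v a")
    case True
    then obtain a b where ab: "a < b" "b < n" "v b < v a" by auto
    let ?v = "v \<circ> Transposition.transpose a b"
    have tr: "Transposition.transpose a b permutes {..<n}" using ab by (intro permutes_swap_id) auto
    have v': "?v permutes {..<n}" using tr v by (rule permutes_compose)
    have vv: "?v \<circ> Transposition.transpose a b = v" by (simp add: comp_assoc)
    have va: "?v a = v b" "?v b = v a" by auto
    have "(\<Sum>j<n. j * v j) < (\<Sum>j<n. j * ?v j)"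
      using sum_mult_transpose_less[of a b n ?v] ab va unfolding vv by simp
    moreover have "(\<Sum>j<n. j * ?v j) \<le> (\<Sum>j<n. n * n)"
      using permutes_in_image[OF v'] by (intro sum_mono mult_le_mono) (auto simp: less_imp_le)
    ultimately have "n * n * n - (\<Sum>j<n. j * ?v j) < n * n * n - (\<Sum>j<n. j * v j)" by simp
    from less.hyps[OF this v'] have "double_coset n id \<subseteq> (schubert_preimage n ?v :: 'k mat set)" .
    also have "\<dots> \<subseteq> schubert_preimage n v"
      using transpose_degeneration[OF v' ab(1,2)] ab(3) va
      unfolding vv by (intro schubert_preimage_mono) simp
    finally show ?thesis .
  next
    case False
    have "v = id"
    proof (rule mono_permutation_eq_id[OF v])
      fix a b assume "a < b" "b < n"
      then have "v a \<le> v b" using False by (meson not_le)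
      moreover have "v a \<noteq> v b" using \<open>a < b\<close> permutes_inj[OF v] by (auto dest: injD)
      ultimately show "v a < v b" by simp
    qed
    then show ?thesis using double_coset_subset_preimage[OF v] by simp
  qed
qed

text \<open>
  Density saves an explicit construction: if the cell did not meet the main neighbourhood of \<open>p\<close>,
  then the constant \<open>1\<close> would vanish on its closure there, which contains \<open>p\<close> itself.
\<close>

lemma chart_cell_nonempty:
  assumes v: "v permutes {..<n}"
  shows "(chart_cell n v :: 'k::field_char_0 mat set) \<noteq> {}"
proof
  assume e: "(chart_cell n v :: 'k mat set) = {}"
  have "1\<^sub>m n * perm_matrix n id * 1\<^sub>m n = (1\<^sub>m n :: 'k mat)"
    by (auto simp: perm_matrix_def intro!: eq_matI)
  then have "(1\<^sub>m n :: 'k mat) \<in> double_coset n id"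
    unfolding double_coset_def using one_borel[of n, where ?'a='k]
    by (intro CollectI exI[of _ "1\<^sub>m n"]) simp
  then have "(1\<^sub>m n + 0\<^sub>m n n :: 'k mat) \<in> schubert_preimage n v"
    using identity_degeneration[OF v] by auto
  moreover have "(0\<^sub>m n n :: 'k mat) \<in> strictly_lower n" by (auto simp: strictly_lower_def)
  ultimately have "(0\<^sub>m n n :: 'k mat) \<in> schubert_chart n v"
    by (simp add: schubert_chart_eq[OF v])
  from chart_cell_dense[OF v function_algebra_const[OF function_algebra_poly_functions] _ this, of 1] e
  show False by simp
qed

section \<open>The Bruhat decomposition\<close>

text \<open>
  Gauss elimination with operations from \<open>B\<close> only, column by column.  In column \<open>k\<close> the lowest
  nonzero entry is the pivot; it clears everything above it in the column and to its right in the
  row.  It cannot lie in the row of an earlier pivot, as these rows have been cleared.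
\<close>

lemma bruhat_reduction:
  fixes g :: "'k::field mat"
  assumes g: "g \<in> general_linear n" and "k \<le> n"
  shows "\<exists>b\<in>borel_subgroup n. \<exists>b'\<in>borel_subgroup n. \<exists>w. inj_on w {..<k} \<and> w ` {..<k} \<subseteq> {..<n} \<and>
    (\<forall>j<k. \<forall>i<n. (b * g * b') $$ (i, j) = (if i = w j then 1 else 0)) \<and>
    (\<forall>j<k. \<forall>c<n. (b * g * b') $$ (w j, c) = (if c = j then 1 else 0))"
  using \<open>k \<le> n\<close>
proof (induction k)
  case 0
  show ?case by (intro bexI[OF _ one_borel] exI[of _ id]) auto
next
  case (Suc k)
  from Suc.IH[OF Suc_leD[OF Suc.prems]]
  obtain b b' w where b: "b \<in> borel_subgroup n" "b' \<in> borel_subgroup n"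
    and w: "inj_on w {..<k}" "w ` {..<k} \<subseteq> {..<n}"
    and col: "\<forall>j<k. \<forall>i<n. (b * g * b') $$ (i, j) = (if i = w j then 1 else 0)"
    and row: "\<forall>j<k. \<forall>c<n. (b * g * b') $$ (w j, c) = (if c = j then 1 else 0)"
    by (elim bexE exE conjE)
  define h where "h = b * g * b'"
  have kn: "k < n" using Suc.prems by simp
  have h: "h \<in> general_linear n"
    unfolding h_def by (intro general_linear_mult borel_general_linear b g)
  then have hc: "h \<in> carrier_mat n n" by (rule general_linear_carrier)
  let ?I = "{i. i < n \<and> h $$ (i, k) \<noteq> 0}"
  have "?I \<noteq> {}"
  proof
    assume e: "?I = {}"
    obtain h' where h': "h' \<in> general_linear n" "h' * h = 1\<^sub>m n"
      using general_linear_inverse[OF h] by metis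
    have "(h' * h) $$ (k, k) = (\<Sum>l<n. h' $$ (k, l) * h $$ (l, k))"
      using kn hc general_linear_carrier[OF h'(1)] by (intro mult_entry)
    also have "\<dots> = 0" using e by (intro sum.neutral) auto
    finally show False using h' kn by simp
  qed
  define i where "i = Max ?I"
  have "i \<in> ?I" unfolding i_def using \<open>?I \<noteq> {}\<close> by (intro Max_in) auto
  then have i: "i < n" "h $$ (i, k) \<noteq> 0" by auto
  have below: "h $$ (r, k) = 0" if "i < r" "r < n" for r
  proof (rule ccontr)
    assume "h $$ (r, k) \<noteq> 0"
    then have "r \<le> i" unfolding i_def using that by (intro Max_ge) auto
    then show False using that by simp
  qed
  have iw: "i \<noteq> w j" if "j < k" for j
    using row[rule_format, OF that kn] that i unfolding h_def by auto
  \<comment> \<open>\<open>u\<close> normalises the pivot \<open>(i, k)\<close> and clears column \<open>k\<close> above it.\<close>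
  define e where "e r = (if r < i then - h $$ (r, k) / h $$ (i, k) else 0)" for r
  define d where "d r = (if r = i then 1 / h $$ (i, k) else 1)" for r
  define u where "u = mat n n (\<lambda>(r, c). (if c = r then d r else 0) + (if c = i then e r else 0))"
  have u: "u \<in> borel_subgroup n"
    using i unfolding borel_iff by (auto simp: u_def d_def e_def upper_triangular_def)
  have uh: "(u * h) $$ (r, c) = d r * h $$ (r, c) + e r * h $$ (i, c)" if "r < n" "c < n" for r c
  proof -
    have "(u * h) $$ (r, c) = (\<Sum>l<n. u $$ (r, l) * h $$ (l, c))"
      using u hc that by (intro mult_entry) auto
    also have "\<dots> = (\<Sum>l<n. ((if l = r then d r else 0) + (if l = i then e r else 0)) * h $$ (l, c))"
      using that by (intro sum.cong) (auto simp: u_def)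
    finally show ?thesis using that i by (simp only: sum_two_terms)
  qed
  have uh_col: "(u * h) $$ (r, k) = (if r = i then 1 else 0)" if "r < n" for r
    using that kn i below[of r] by (cases r i rule: linorder_cases) (auto simp: uh d_def e_def)
  \<comment> \<open>\<open>x\<close> clears row \<open>i\<close> to the right of the pivot.\<close>
  define z where "z c = (if k < c then - (u * h) $$ (i, c) else 0)" for c
  define x where "x = mat n n (\<lambda>(r, c). (if r = c then 1 else 0) + (if r = k then z c else 0))"
  have x: "x \<in> borel_subgroup n"
    unfolding borel_iff by (auto simp: x_def z_def upper_triangular_def)
  have uhc: "u * h \<in> carrier_mat n n" using u hc by simp
  have uhx: "(u * h * x) $$ (r, c) = (u * h) $$ (r, c) + z c * (u * h) $$ (r, k)" if "r < n" "c < n" for r c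
  proof -
    have "(u * h * x) $$ (r, c) = (\<Sum>l<n. (u * h) $$ (r, l) * x $$ (l, c))"
      using x uhc that by (intro mult_entry) auto
    also have "\<dots> = (\<Sum>l<n. ((if l = c then 1 else 0) + (if l = k then z c else 0)) * (u * h) $$ (r, l))"
      using that by (intro sum.cong) (auto simp: x_def)
    finally show ?thesis using that kn by (simp only: sum_two_terms mult_1)
  qed
  have eq: "(u * b) * g * (b' * x) = u * h * x"
  proof -
    note c = borel_carrier[OF u] borel_carrier[OF x] borel_carrier[OF b(1)] borel_carrier[OF b(2)]
      general_linear_carrier[OF g]
    show ?thesis unfolding h_def using c by (simp add: square_mult_assoc[of _ n])
  qed
  have hcol: "h $$ (r, j) = (if r = w j then 1 else 0)" if "j < k" "r < n" for r j
    using col[rule_format, OF that] unfolding h_def by simp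
  have hrow: "h $$ (w j, c) = (if c = j then 1 else 0)" if "j < k" "c < n" for c j
    using row[rule_format, OF that] unfolding h_def by simp
  let ?w = "w(k := i)"
  have wn: "w j < n" if "j < k" for j using w that by auto
  have "(u * h * x) $$ (r, j) = (if r = ?w j then 1 else 0)" if "j < Suc k" "r < n" for r j
  proof (cases "j = k")
    case True
    then show ?thesis using that kn by (simp add: uhx uh_col z_def)
  next
    case False
    then have j: "j < k" using that by simp
    have "(u * h * x) $$ (r, j) = d r * h $$ (r, j)"
      using j that kn i iw[OF j] by (simp add: uhx uh z_def hcol[OF j])
    then show ?thesis using j that False iw[OF j] by (auto simp: hcol[OF j] d_def)
  qed
  moreover have "(u * h * x) $$ (?w j, c) = (if c = j then 1 else 0)" if "j < Suc k" "c < n" for c j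
  proof (cases "j = k")
    case True
    have "(u * h) $$ (i, c) = 0" if "c < k"
      using that i kn iw[OF that] by (simp add: uh hcol[OF that])
    then show ?thesis
      using True that i kn uh_col[OF i(1)]
      by (cases c k rule: linorder_cases) (auto simp: uhx z_def)
  next
    case False
    then have j: "j < k" using that by simp
    have "(u * h) $$ (w j, c) = (if c = j then 1 else 0)"
      using that j wn[OF j] kn iw[OF j] by (simp add: uh hrow[OF j] d_def e_def)
    then show ?thesis
      using that j wn[OF j] kn iw[OF j] False by (simp add: uhx uh_col)
  qed
  moreover have "inj_on ?w {..<Suc k}"
  proof (rule inj_onI)
    fix p q assume "p \<in> {..<Suc k}" "q \<in> {..<Suc k}" "?w p = ?w q"
    then show "p = q"
      using inj_onD[OF w(1), of p q] iw[of p] iw[of q] by (cases "p = k"; cases "q = k") auto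
  qed
  moreover have "?w ` {..<Suc k} \<subseteq> {..<n}" using wn i by (auto simp: less_Suc_eq)
  ultimately have P: "inj_on ?w {..<Suc k} \<and> ?w ` {..<Suc k} \<subseteq> {..<n} \<and>
      (\<forall>j<Suc k. \<forall>r<n. (u * h * x) $$ (r, j) = (if r = ?w j then 1 else 0)) \<and>
      (\<forall>j<Suc k. \<forall>c<n. (u * h * x) $$ (?w j, c) = (if c = j then 1 else 0))"
    by (intro conjI allI impI)
  show ?case
    by (rule bexI[OF _ borel_mult[OF u b(1)]], rule bexI[OF _ borel_mult[OF b(2) x]],
        rule exI[of _ ?w], unfold eq, rule P)
qed

theorem bruhat_decomposition:
  fixes g :: "'k::field mat"
  assumes g: "g \<in> general_linear n"
  obtains w where "w permutes {..<n}" "g \<in> double_coset n w"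
proof -
  from bruhat_reduction[OF g order_refl]
  obtain b b' w where b: "b \<in> borel_subgroup n" "b' \<in> borel_subgroup n"
    and w: "inj_on w {..<n}" "w ` {..<n} \<subseteq> {..<n}"
    and col: "\<forall>j<n. \<forall>i<n. (b * g * b') $$ (i, j) = (if i = w j then 1 else 0)"
    by (elim bexE exE conjE)
  define v where "v j = (if j < n then w j else j)" for j
  have "bij_betw w {..<n} {..<n}"
    using w by (simp add: bij_betw_def endo_inj_surj)
  then have "bij_betw v {..<n} {..<n}"
    by (subst bij_betw_cong[of _ v w]) (auto simp: v_def)
  then have v: "v permutes {..<n}" by (rule bij_imp_permutes) (auto simp: v_def)
  have gc: "g \<in> carrier_mat n n" by (rule general_linear_carrier[OF g])
  have eq: "b * g * b' = perm_matrix n v"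
    using borel_carrier[OF b(1)] borel_carrier[OF b(2)] gc
    by (intro eq_matI) (auto simp: perm_matrix_def v_def col simp del: index_mult_mat(1) assoc_mult_mat)
  obtain c where c: "c \<in> borel_subgroup n" "c * b = 1\<^sub>m n" using borel_inverse[OF b(1)] by metis
  obtain c' where c': "c' \<in> borel_subgroup n" "b' * c' = 1\<^sub>m n" using borel_inverse[OF b(2)] by metis
  note cr = borel_carrier[OF c(1)] borel_carrier[OF c'(1)] borel_carrier[OF b(1)]
    borel_carrier[OF b(2)] gc
  have "c * (b * g * b') * c' = (c * b) * g * (b' * c')"
    using cr by (simp add: square_mult_assoc[of _ n])
  also have "\<dots> = g" using gc c c' by simp
  finally have "g \<in> double_coset n v" using c c' eq by (auto simp: double_coset_def)
  with v show ?thesis using that by blast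
qed

section \<open>Basic cells\<close>

lemma mult3_entry:
  fixes Z :: "'k::field mat"
  assumes b: "b \<in> carrier_mat n n" and Z: "Z \<in> carrier_mat n n" and c: "c \<in> carrier_mat n n"
    and ij: "i < n" "j < n"
  shows "(b * Z * c) $$ (i, j) = (\<Sum>k<n. (\<Sum>l<n. b $$ (i, l) * Z $$ (l, k)) * c $$ (k, j))"
proof -
  have "b * Z \<in> carrier_mat n n" using b Z by simp
  then show ?thesis
    unfolding mult_entry[OF \<open>b * Z \<in> _\<close> c ij] using ij by (simp add: mult_entry[OF b Z])
qed

lemma strictly_lower_part_carrier [simp]:
  "A \<in> carrier_mat n n \<Longrightarrow> strictly_lower_part A \<in> carrier_mat n n"
  by (auto simp: strictly_lower_part_def)

lemma strictly_lower_part_entry: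
  "A \<in> carrier_mat n n \<Longrightarrow> i < n \<Longrightarrow> j < n \<Longrightarrow>
     strictly_lower_part A $$ (i, j) = (if j < i then A $$ (i, j) else 0)"
  by (auto simp: strictly_lower_part_def)

lemma strictly_lower_part_strictly_lower:
  "A \<in> carrier_mat n n \<Longrightarrow> strictly_lower_part A \<in> strictly_lower n"
  by (auto simp: strictly_lower_part_def strictly_lower_def)

lemma strictly_lower_part_add_one:
  fixes X :: "'k::field mat"
  shows "X \<in> strictly_lower n \<Longrightarrow> strictly_lower_part (1\<^sub>m n + X) = X"
  by (rule eq_matI) (auto simp: strictly_lower_part_def strictly_lower_def)

text \<open>
  Upper triangular matrices are stable under multiplication by upper triangular matrices from both
  sides, so the entries of \<open>b Z c\<close> below the diagonal do not see those of \<open>Z\<close> on or above it.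
\<close>

lemma strictly_lower_part_absorb:
  fixes Z :: "'k::field mat"
  assumes b: "b \<in> borel_subgroup n" and c: "c \<in> borel_subgroup n" and Z: "Z \<in> carrier_mat n n"
  shows "strictly_lower_part (b * strictly_lower_part Z * c) = strictly_lower_part (b * Z * c)"
    (is "?L = ?R")
proof (rule eq_matI)
  have bc: "b \<in> carrier_mat n n" "c \<in> carrier_mat n n" using b c by auto
  note m = mult3_entry[OF bc(1) _ bc(2)]
  have C: "b * Z * c \<in> carrier_mat n n" "b * strictly_lower_part Z * c \<in> carrier_mat n n"
    using bc Z by auto
  then show d: "dim_row ?L = dim_row ?R" "dim_col ?L = dim_col ?R"
    by (auto simp: strictly_lower_part_def)
  fix i j assume "i < dim_row ?R" "j < dim_col ?R"
  then have ij: "i < n" "j < n" using C(1) by (auto simp: strictly_lower_part_def)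
  have "(b * strictly_lower_part Z * c) $$ (i, j) = (b * Z * c) $$ (i, j)" if ji: "j < i"
  proof -
    have "(b $$ (i, l) * strictly_lower_part Z $$ (l, k)) * c $$ (k, j) =
        (b $$ (i, l) * Z $$ (l, k)) * c $$ (k, j)" if "k < n" "l < n" for k l
    proof -
      consider "l < i" | "j < k" | "k < l" using ji by linarith
      then show ?thesis
      proof cases
        case 1
        then have "b $$ (i, l) = 0" using borel_upper_triangular[OF b] bc ij
          by (auto simp: upper_triangular_def)
        then show ?thesis by simp
      next
        case 2
        then have "c $$ (k, j) = 0" using borel_upper_triangular[OF c] bc that
          by (auto simp: upper_triangular_def)
        then show ?thesis by simp
      next
        case 3
        then show ?thesis using that by (simp add: strictly_lower_part_entry[OF Z])
      qed
    qed
    then show ?thesis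
      unfolding m[OF Z ij] m[OF strictly_lower_part_carrier[OF Z] ij] sum_distrib_right
      by (intro sum.cong) auto
  qed
  then show "?L $$ (i, j) = ?R $$ (i, j)"
    unfolding strictly_lower_part_entry[OF C(1) ij] strictly_lower_part_entry[OF C(2) ij] by simp
qed

abbreviation rook_matrix :: "nat \<Rightarrow> (nat \<times> nat) set \<Rightarrow> 'k::field mat" where
  "rook_matrix n D \<equiv> basic_matrix n D (\<lambda>_. 1)"

lemma basic_matrix_carrier [simp]: "basic_matrix n D \<phi> \<in> carrier_mat n n"
  by (simp add: basic_matrix_def)

lemma basic_subset_bounds: "basic_subset n D \<Longrightarrow> (i, j) \<in> D \<Longrightarrow> j < i \<and> i < n"
  by (auto simp: basic_subset_def pos_roots_def)

lemma basic_subset_row: "basic_subset n D \<Longrightarrow> (i, j) \<in> D \<Longrightarrow> (i, j') \<in> D \<Longrightarrow> j = j'"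
  by (force simp: basic_subset_def)

lemma basic_subset_col: "basic_subset n D \<Longrightarrow> (i, j) \<in> D \<Longrightarrow> (i', j) \<in> D \<Longrightarrow> i = i'"
  by (force simp: basic_subset_def)

text \<open>
  With the next lemma: the union over \<open>\<phi>\<close> turns the orbits of pairs of unitriangular matrices into
  a single orbit of \<open>B \<times> B\<close>, because the torus rescales the nonzero entries arbitrarily, and each
  upper triangular matrix is a product of a unitriangular and a diagonal one.
\<close>

lemma basic_cell_subset_orbit:
  fixes X :: "'k::field mat"
  assumes D: "basic_subset n D" and X: "X \<in> basic_cell n D"
  obtains b c where "b \<in> borel_subgroup n" "c \<in> borel_subgroup n"
    "X = strictly_lower_part (b * rook_matrix n D * c)"
proof -
  obtain \<phi> g h where \<phi>: "\<forall>\<xi>\<in>D. \<phi> \<xi> \<noteq> 0" and gh: "g \<in> upper_unitriangular n" "h \<in> upper_unitriangular n"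
    and X: "X = left_right_action g h (basic_matrix n D \<phi>)"
    using X by (auto simp: basic_cell_def basic_variety_def)
  obtain c where c: "c \<in> upper_unitriangular n" "mat_inverse h = Some c"
    using upper_unitriangular_inverse[OF gh(2)] by metis
  \<comment> \<open>At most one root of \<open>D\<close> lies in row \<open>i\<close>; its value \<open>\<phi>\<close> is the scaling factor of that row.\<close>
  define r where "r i = (if \<exists>j. (i, j) \<in> D then \<phi> (i, SOME j. (i, j) \<in> D) else 1)" for i
  have r: "r i = \<phi> (i, j)" if "(i, j) \<in> D" for i j
  proof -
    have "(i, SOME j. (i, j) \<in> D) \<in> D" using that by (rule someI)
    then have "(SOME j. (i, j) \<in> D) = j" using basic_subset_row[OF D _ that] by simp
    then show ?thesis using that by (auto simp: r_def)
  qed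
  have "r i \<noteq> 0" for i
  proof (cases "\<exists>j. (i, j) \<in> D")
    case True
    then obtain j where "(i, j) \<in> D" by auto
    then show ?thesis using \<phi> r by simp
  qed (simp add: r_def)
  then have T: "mat_diag n r \<in> borel_subgroup n"
    unfolding borel_iff by (auto simp: mat_diag_def upper_triangular_def)
  have "basic_matrix n D \<phi> = mat_diag n r * rook_matrix n D"
    unfolding mat_diag_mult_left[OF basic_matrix_carrier]
    by (rule eq_matI) (auto simp: basic_matrix_def r)
  then have "X = strictly_lower_part (g * (mat_diag n r * rook_matrix n D) * c)"
    using X c by (simp add: left_right_action_def)
  also have "g * (mat_diag n r * rook_matrix n D) = g * mat_diag n r * rook_matrix n D"
    using upper_unitriangular_borel[OF gh(1)] T by (intro square_mult_assoc[symmetric, of _ n]) auto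
  finally show ?thesis
    using that borel_mult[OF upper_unitriangular_borel[OF gh(1)] T] upper_unitriangular_borel[OF c(1)]
    by blast
qed

lemma orbit_subset_basic_cell:
  fixes b c :: "'k::field mat"
  assumes D: "basic_subset n D" and b: "b \<in> borel_subgroup n" and c: "c \<in> borel_subgroup n"
  shows "strictly_lower_part (b * rook_matrix n D * c) \<in> basic_cell n D"
proof -
  have nz: "b $$ (i, i) \<noteq> 0" "c $$ (i, i) \<noteq> 0" if "i < n" for i
    using b c that unfolding borel_iff by auto
  define \<phi> where "\<phi> = (\<lambda>(i, j). b $$ (i, i) * c $$ (j, j))"
  define g where "g = mat n n (\<lambda>(i, j). b $$ (i, j) / b $$ (j, j))"
  define h where "h = mat n n (\<lambda>(i, j). c $$ (i, j) / c $$ (i, i))"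
  have g: "g \<in> upper_unitriangular n" and h: "h \<in> upper_unitriangular n"
    using b c nz by (auto simp: g_def h_def upper_unitriangular_def upper_triangular_def borel_iff
        dest!: borel_upper_triangular)
  have gc: "g \<in> carrier_mat n n" "h \<in> carrier_mat n n" by (auto simp: g_def h_def)
  have ut: "b $$ (i, l) = 0" "c $$ (i, l) = 0" if "l < i" "i < n" for i l
    using borel_upper_triangular[OF b] borel_upper_triangular[OF c] borel_carrier[OF b]
      borel_carrier[OF c] that by (auto simp: upper_triangular_def)
  have "b * rook_matrix n D * c = g * basic_matrix n D \<phi> * h"
  proof (rule eq_matI)
    fix i j assume "i < dim_row (g * basic_matrix n D \<phi> * h)" "j < dim_col (g * basic_matrix n D \<phi> * h)"
    then have ij: "i < n" "j < n" by (auto simp: g_def h_def)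
    have "(b $$ (i, l) * rook_matrix n D $$ (l, k)) * c $$ (k, j) =
        (g $$ (i, l) * basic_matrix n D \<phi> $$ (l, k)) * h $$ (k, j)" if "l < n" "k < n" for l k
      using that nz[OF that(1)] nz[OF that(2)] ij
      by (auto simp: g_def h_def basic_matrix_def \<phi>_def)
    then show "(b * rook_matrix n D * c) $$ (i, j) = (g * basic_matrix n D \<phi> * h) $$ (i, j)"
      unfolding mult3_entry[OF borel_carrier[OF b] basic_matrix_carrier borel_carrier[OF c] ij]
        mult3_entry[OF gc(1) basic_matrix_carrier gc(2) ij] sum_distrib_right
      by (intro sum.cong) auto
  qed (use borel_carrier[OF b] borel_carrier[OF c] in \<open>auto simp: g_def h_def\<close>)
  moreover obtain h' where h': "h' \<in> upper_unitriangular n" "h' * h = 1\<^sub>m n"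
    using upper_unitriangular_inverse[OF h] by metis
  moreover have "mat_inverse h' = Some h"
  proof -
    obtain h'' where h'': "mat_inverse h' = Some h''" "h'' * h' = 1\<^sub>m n" "h'' \<in> upper_unitriangular n"
      using upper_unitriangular_inverse[OF h'(1)] by metis
    have cc: "h' \<in> carrier_mat n n" "h'' \<in> carrier_mat n n"
      using h' h'' by (auto simp: upper_unitriangular_def)
    have "h = h'' * h' * h" using h'' gc by simp
    also have "\<dots> = h'' * (h' * h)" using cc gc by (intro square_mult_assoc)
    also have "\<dots> = h''" using h' cc by simp
    finally show ?thesis using h'' by simp
  qed
  ultimately have "strictly_lower_part (b * rook_matrix n D * c) =
      left_right_action g h' (basic_matrix n D \<phi>)"
    by (simp add: left_right_action_def)
  moreover have "\<forall>\<xi>\<in>D. \<phi> \<xi> \<noteq> 0"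
    using nz basic_subset_bounds[OF D] by (force simp: \<phi>_def)
  ultimately show ?thesis
    using g h'(1) unfolding basic_cell_def basic_variety_def by blast
qed

lemma basic_cell_strictly_lower:
  "basic_subset n D \<Longrightarrow> basic_cell n D \<subseteq> strictly_lower n"
  by (auto elim!: basic_cell_subset_orbit intro!: strictly_lower_part_strictly_lower square_mult_carrier)

text \<open>
  At the place \<open>(i, j)\<close> of \<open>D\<close> the left side has the entry \<open>b\<^sub>i\<^sub>i \<noteq> 0\<close>, and the right side can only be
  nonzero there if \<open>D'\<close> has a root in row \<open>i\<close> at or to the left of column \<open>j\<close>.
\<close>

lemma rook_row_shift:
  fixes b c :: "'k::field mat"
  assumes D: "basic_subset n D" and b: "b \<in> borel_subgroup n" and c: "c \<in> borel_subgroup n"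
    and eq: "strictly_lower_part (b * rook_matrix n D) = strictly_lower_part (rook_matrix n D' * c)"
    and ij: "(i, j) \<in> D"
  shows "\<exists>e\<le>j. (i, e) \<in> D'"
proof -
  have n: "j < i" "i < n" "j < n" using basic_subset_bounds[OF D ij] by auto
  have bc: "b * rook_matrix n D \<in> carrier_mat n n" "rook_matrix n D' * c \<in> carrier_mat n n"
    using b c by auto
  have "(b * rook_matrix n D) $$ (i, j) = (\<Sum>k<n. b $$ (i, k) * rook_matrix n D $$ (k, j))"
    using b n by (intro mult_entry[of _ n n _ n]) auto
  also have "\<dots> = b $$ (i, i) * rook_matrix n D $$ (i, j)"
    using n basic_subset_col[OF D ij] by (intro sum_single_term) (auto simp: basic_matrix_def)
  also have "\<dots> \<noteq> 0" using b n ij unfolding borel_iff by (auto simp: basic_matrix_def)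
  finally have "(rook_matrix n D' * c) $$ (i, j) \<noteq> 0"
    using n arg_cong[OF eq, of "\<lambda>M. M $$ (i, j)"]
    by (simp add: strictly_lower_part_entry[OF bc(1)] strictly_lower_part_entry[OF bc(2)]
        del: index_mult_mat(1))
  also have "(rook_matrix n D' * c) $$ (i, j) = (\<Sum>k<n. rook_matrix n D' $$ (i, k) * c $$ (k, j))"
    using c n by (intro mult_entry[of _ n n _ n]) auto
  finally obtain k where k: "k < n" "rook_matrix n D' $$ (i, k) * c $$ (k, j) \<noteq> 0"
    by (meson lessThan_iff sum.neutral)
  then have "(i, k) \<in> D'" using n by (auto simp: basic_matrix_def split: if_splits)
  moreover have "k \<le> j"
    using k borel_upper_triangular[OF c] borel_carrier[OF c]
    by (auto simp: upper_triangular_def not_less[symmetric])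
  ultimately show ?thesis by auto
qed

lemma orbit_rook_row_shift:
  fixes b b' c c' :: "'k::field mat"
  assumes D: "basic_subset n D" and b: "b \<in> borel_subgroup n" "b' \<in> borel_subgroup n"
    and c: "c \<in> borel_subgroup n" "c' \<in> borel_subgroup n"
    and eq: "strictly_lower_part (b * rook_matrix n D * b') = strictly_lower_part (c * rook_matrix n D' * c')"
    and ij: "(i, j) \<in> D"
  shows "\<exists>e\<le>j. (i, e) \<in> D'"
proof -
  obtain u where u: "u \<in> borel_subgroup n" "u * c = 1\<^sub>m n" using borel_inverse[OF c(1)] by metis
  obtain u' where u': "u' \<in> borel_subgroup n" "b' * u' = 1\<^sub>m n" using borel_inverse[OF b(2)] by metis
  note cr = borel_carrier[OF u(1)] borel_carrier[OF u'(1)] borel_carrier[OF b(1)]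
    borel_carrier[OF b(2)] borel_carrier[OF c(1)] borel_carrier[OF c(2)]
  let ?X = "rook_matrix n D :: 'k mat" and ?X' = "rook_matrix n D' :: 'k mat"
  have "u * (b * ?X * b') * u' = (u * b) * ?X * (b' * u')"
    using cr by (simp add: square_mult_assoc[of _ n])
  then have 1: "u * (b * ?X * b') * u' = (u * b) * ?X" using cr u' by simp
  have "u * (c * ?X' * c') * u' = (u * c) * ?X' * (c' * u')"
    using cr by (simp add: square_mult_assoc[of _ n])
  then have 2: "u * (c * ?X' * c') * u' = ?X' * (c' * u')" using u by simp
  have "strictly_lower_part ((u * b) * ?X) = strictly_lower_part (?X' * (c' * u'))"
    using arg_cong[OF eq, of "\<lambda>Z. strictly_lower_part (u * Z * u')"] cr
    unfolding 1[symmetric] 2[symmetric]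
    by (simp only: strictly_lower_part_absorb[OF u(1) u'(1)] square_mult_carrier basic_matrix_carrier)
  from rook_row_shift[OF D borel_mult[OF u(1) b(1)] borel_mult[OF c(2) u'(1)] this ij]
  show ?thesis .
qed

text \<open>
  Going from \<open>D\<close> to \<open>D'\<close> and back moves the root in row \<open>i\<close> weakly to the left twice, and returns to
  the only root of \<open>D\<close> in that row; so it never moved.
\<close>

lemma basic_cells_disjoint:
  fixes X :: "'k::field mat"
  assumes D: "basic_subset n D" and D': "basic_subset n D'"
    and X: "X \<in> basic_cell n D" "X \<in> basic_cell n D'"
  shows "D = D'"
proof -
  obtain b b' where b: "b \<in> borel_subgroup n" "b' \<in> borel_subgroup n"
    "X = strictly_lower_part (b * rook_matrix n D * b')"
    using basic_cell_subset_orbit[OF D X(1)] .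
  obtain c c' where c: "c \<in> borel_subgroup n" "c' \<in> borel_subgroup n"
    "X = strictly_lower_part (c * rook_matrix n D' * c')"
    using basic_cell_subset_orbit[OF D' X(2)] .
  have eq: "strictly_lower_part (b * rook_matrix n D * b') =
      strictly_lower_part (c * rook_matrix n D' * c')" using b(3) c(3) by simp
  have 1: "\<exists>e\<le>j. (i, e) \<in> D'" if "(i, j) \<in> D" for i j
    using orbit_rook_row_shift[OF D b(1,2) c(1,2) eq that] .
  have 2: "\<exists>e\<le>j. (i, e) \<in> D" if "(i, j) \<in> D'" for i j
    using orbit_rook_row_shift[OF D' c(1,2) b(1,2) eq[symmetric] that] .
  have "(i, j) \<in> D'" if "(i, j) \<in> D" for i j
  proof -
    obtain e where e: "e \<le> j" "(i, e) \<in> D'" using 1 \<open>(i, j) \<in> D\<close> by blast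
    obtain e' where e': "e' \<le> e" "(i, e') \<in> D" using 2 e by blast
    show ?thesis using basic_subset_row[OF D that e'(2)] e e' by simp
  qed
  moreover have "(i, j) \<in> D" if "(i, j) \<in> D'" for i j
  proof -
    obtain e where e: "e \<le> j" "(i, e) \<in> D" using 2 \<open>(i, j) \<in> D'\<close> by blast
    obtain e' where e': "e' \<le> e" "(i, e') \<in> D'" using 1 e by blast
    show ?thesis using basic_subset_row[OF D' that e'(2)] e e' by simp
  qed
  ultimately show ?thesis by auto
qed

section \<open>Excedances\<close>

definition excedances :: "(nat \<Rightarrow> nat) \<Rightarrow> (nat \<times> nat) set" where
  "excedances w = {(w j, j) | j. j < w j}"

lemma excedances_basic:
  assumes "w permutes {..<n}"
  shows "basic_subset n (excedances w)"
proof -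
  have "w j < n" if "j < w j" for j
    using permutes_in_image[OF assms, of j] permutes_not_in[OF assms, of j] that by (cases "j < n") auto
  then show ?thesis
    using permutes_inj[OF assms] by (auto simp: basic_subset_def excedances_def pos_roots_def dest: injD)
qed

lemma strictly_lower_part_double_coset:
  assumes w: "w permutes {..<n}" and b: "b \<in> borel_subgroup n" and c: "c \<in> borel_subgroup n"
  shows "strictly_lower_part (b * perm_matrix n w * c) =
    strictly_lower_part (b * rook_matrix n (excedances w) * c)"
proof -
  have "strictly_lower_part (perm_matrix n w) = rook_matrix n (excedances w)"
    by (rule eq_matI) (auto simp: strictly_lower_part_def perm_matrix_def basic_matrix_def excedances_def)
  then show ?thesis using strictly_lower_part_absorb[OF b c perm_matrix_carrier] by metis
qed

lemma chart_cell_subset_basic_cell: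
  assumes w: "w permutes {..<n}"
  shows "chart_cell n w \<subseteq> basic_cell n (excedances w)"
proof
  fix X assume "X \<in> chart_cell n w"
  then obtain b c where X: "X \<in> strictly_lower n" and b: "b \<in> borel_subgroup n" "c \<in> borel_subgroup n"
    and eq: "1\<^sub>m n + X = b * perm_matrix n w * c"
    by (auto simp: chart_cell_def double_coset_def)
  have "X = strictly_lower_part (b * rook_matrix n (excedances w) * c)"
    unfolding strictly_lower_part_double_coset[OF w b, symmetric] eq[symmetric]
    using strictly_lower_part_add_one[OF X] by simp
  then show "X \<in> basic_cell n (excedances w)"
    using orbit_subset_basic_cell[OF excedances_basic[OF w] b] by simp
qed

text \<open>
  The permutation is the one of the Bruhat decomposition of \<open>1 + X\<close>; disjointness of basic cells
  identifies its excedances.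
\<close>

lemma basic_cell_covered_by_chart_cells:
  assumes D: "basic_subset n D" and X: "X \<in> basic_cell n D"
  obtains v where "v permutes {..<n}" "excedances v = D" "X \<in> chart_cell n v"
proof -
  have XL: "X \<in> strictly_lower n" using basic_cell_strictly_lower[OF D] X by blast
  obtain v where v: "v permutes {..<n}" "1\<^sub>m n + X \<in> double_coset n v"
    using bruhat_decomposition[OF lower_unitriangular_general_linear[OF strictly_lower_add_one[OF XL]]] .
  then have Xv: "X \<in> chart_cell n v" using XL by (simp add: chart_cell_def)
  then have "X \<in> basic_cell n (excedances v)" using chart_cell_subset_basic_cell[OF v(1)] by blast
  then have "excedances v = D" using basic_cells_disjoint[OF excedances_basic[OF v(1)] D _ X] by simp
  then show ?thesis using that v Xv by blast
qed

text \<open>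
  Picture each place \<open>j\<close> with \<open>w j \<le> j\<close> as an arc from \<open>j\<close> down to \<open>w j\<close>.  Two such arcs with
  \<open>w k < w l \<le> k < l\<close> cross each other (or touch, if \<open>w l = k\<close>).
\<close>

definition crossing :: "(nat \<Rightarrow> nat) \<Rightarrow> nat \<Rightarrow> nat \<Rightarrow> bool" where
  "crossing w k l \<longleftrightarrow> k < l \<and> w k < w l \<and> w l \<le> k"

text \<open>
  The greedy rule picks at \<open>j\<close> the largest unused row outside \<open>M(D)\<close>.  Suppose it could pick a row
  \<open>i > w j\<close>.  This row is used by \<open>w\<close> later, so \<open>i \<le> j\<close> would be a crossing.  If \<open>i > j\<close>, then
  \<open>(i, j)\<close> is singular: either a root of \<open>D\<close> lies below it in column \<open>j\<close>, which makes \<open>w j\<close> larger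
  than \<open>i\<close>, or to its left in row \<open>i\<close>, which means that the row has been used before.
\<close>

lemma noncrossing_eq_basic_perm:
  assumes w: "w permutes {..<n}" and nc: "\<And>k l. l < n \<Longrightarrow> \<not> crossing w k l"
  shows "w = basic_perm n (excedances w)"
proof
  fix j
  show "w j = basic_perm n (excedances w) j"
  proof (induction j rule: less_induct)
    case (less j)
    let ?D = "excedances w"
    have inj: "w x = w y \<longleftrightarrow> x = y" for x y using permutes_inj[OF w] by (auto dest: injD)
    have wn: "w x < n" if "x < n" for x using permutes_in_image[OF w, of x] that by auto
    show ?case
    proof (cases "j < n")
      case False
      then show ?thesis using permutes_not_in[OF w, of j] by (simp add: basic_perm.simps)
    next
      case True
      have im: "basic_perm n ?D ` {..<j} = w ` {..<j}" using less by (intro image_cong) auto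
      let ?A = "{i. i < n \<and> (i, j) \<notin> M_roots n ?D \<and> i \<notin> w ` {..<j}}"
      have "Max ?A = w j"
      proof (rule Max_eqI)
        have "(w j, j) \<notin> M_roots n ?D"
          by (auto simp: M_roots_def regular_roots_def pos_roots_def excedances_def)
        then show "w j \<in> ?A" using wn[OF True] inj by auto
      next
        fix i assume i: "i \<in> ?A"
        show "i \<le> w j"
        proof (rule ccontr)
          assume "\<not> i \<le> w j"
          then have wi: "w j < i" by simp
          obtain k where k: "w k = i" using permutes_surj[OF w] by (metis surjD)
          have kn: "k < n" using i k permutes_not_in[OF w, of k] by (cases "k < n") auto
          have "j < k" using i k wi by (cases k j rule: linorder_cases) auto
          show False
          proof (cases "i \<le> j")
            case True
            then show False using nc[OF kn, of j] \<open>j < k\<close> wi k by (simp add: crossing_def)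
          next
            case False
            have "(i, j) \<notin> ?D" using wi by (auto simp: excedances_def)
            then have "(i, j) \<in> singular_roots n ?D"
              using i False by (auto simp: M_roots_def regular_roots_def pos_roots_def)
            then obtain \<beta> \<gamma> where g: "\<gamma> \<in> ?D" "root_sum (i, j) \<beta> \<gamma>"
              by (auto simp: singular_roots_def)
            then obtain p q r where pqr: "p > q" "q > r" "\<gamma> = (p, r)" "{(i, j), \<beta>} = {(p, q), (q, r)}"
              unfolding root_sum_def by blast
            have wr: "w r = p" using g(1) pqr(3) by (auto simp: excedances_def)
            from pqr(4) have "(i, j) = (p, q) \<or> (i, j) = (q, r)" by (metis insertI1 insertE singletonD)
            then show False
            proof
              assume "(i, j) = (p, q)"
              then have "w r = i" "r < j" using wr pqr by auto
              then show False using i by auto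
            next
              assume "(i, j) = (q, r)"
              then show False using wr pqr wi by auto
            qed
          qed
        qed
      qed auto
      then show ?thesis using True im by (subst basic_perm.simps) simp
    qed
  qed
qed

lemma excedances_uncross:
  assumes "crossing v k l"
  shows "excedances (v \<circ> Transposition.transpose k l) = excedances v"
proof -
  have c: "k < l" "v k < v l" "v l \<le> k" using assms by (auto simp: crossing_def)
  have "j < (v \<circ> Transposition.transpose k l) j \<longleftrightarrow> j < v j" for j
    using c by (cases "j = k"; cases "j = l") auto
  moreover have "(v \<circ> Transposition.transpose k l) j = v j" if "j < v j" for j
    using c that by (cases "j = k"; cases "j = l") auto
  ultimately show ?thesis unfolding excedances_def by (metis (no_types, lifting))
qed

text \<open>
  Exchanging the values of crossings as long as there are any leads from \<open>v\<close>, upwards in the Bruhat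
  order and with constant excedances, to the permutation without crossings.
\<close>

lemma degenerates_from_basic_perm:
  assumes v: "v permutes {..<n}" and D: "excedances v = D"
  shows "basic_perm n D permutes {..<n} \<and> excedances (basic_perm n D) = D \<and>
    (\<forall>k l. l < n \<longrightarrow> \<not> crossing (basic_perm n D) k l) \<and>
    double_coset n v \<subseteq> (schubert_preimage n (basic_perm n D) :: 'k::field_char_0 mat set)"
  using v D
proof (induction "\<Sum>j<n. j * v j" arbitrary: v rule: less_induct)
  case less
  note v = \<open>v permutes {..<n}\<close>
  show ?case
  proof (cases "\<exists>k l. l < n \<and> crossing v k l")
    case True
    then obtain k l where kl: "l < n" "crossing v k l" by auto
    let ?v = "v \<circ> Transposition.transpose k l"
    have c: "k < l" "l < n" "v k < v l" using kl by (auto simp: crossing_def)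
    have tr: "Transposition.transpose k l permutes {..<n}" using c by (intro permutes_swap_id) auto
    have v': "?v permutes {..<n}" using tr v by (rule permutes_compose)
    have IH: "basic_perm n D permutes {..<n} \<and> excedances (basic_perm n D) = D \<and>
      (\<forall>k l. l < n \<longrightarrow> \<not> crossing (basic_perm n D) k l) \<and>
      double_coset n ?v \<subseteq> (schubert_preimage n (basic_perm n D) :: 'k mat set)"
      using excedances_uncross[OF kl(2)] less.prems
      by (intro less.hyps sum_mult_transpose_less c v') simp
    then have "schubert_preimage n ?v \<subseteq> (schubert_preimage n (basic_perm n D) :: 'k mat set)"
      by (intro schubert_preimage_mono) simp
    with transpose_degeneration[OF v c] IH show ?thesis by blast
  next
    case False
    then have "v = basic_perm n D"
      using noncrossing_eq_basic_perm[OF v] less.prems by blast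
    then show ?thesis using less.prems False double_coset_subset_preimage[OF v] by auto
  qed
qed

text \<open>
  A point of the basic cell of \<open>D\<close>, over any field, lies in some \<open>A\<^sub>v\<close> with \<open>D(v) = D\<close>; the field of
  rational numbers will do.
\<close>

lemma basic_subset_excedances:
  assumes D: "basic_subset n D"
  obtains v where "v permutes {..<n}" "excedances v = D"
proof -
  have "strictly_lower_part (1\<^sub>m n * rook_matrix n D * 1\<^sub>m n) \<in> (basic_cell n D :: rat mat set)"
    by (intro orbit_subset_basic_cell D one_borel)
  from basic_cell_covered_by_chart_cells[OF D this] that show ?thesis by blast
qed

text \<open>
  For the inclusion of \<open>V\<^sub>D\<close> all the pieces \<open>A\<^sub>v\<close> of the basic cell lie in the Schubert variety of the
  largest permutation \<open>w\<^sub>D\<close>; for the converse \<open>A\<^sub>w\<close> with \<open>w = w\<^sub>D\<close> is one of these pieces and is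
  dense in \<open>Y\<^sub>w\<close>.
\<close>

theorem basic_cone_eq_schubert_chart:
  assumes D: "basic_subset n D"
  shows "basic_cone n D = (schubert_chart n (basic_perm n D) :: 'k::field_char_0 mat set)"
proof -
  obtain v0 where v0: "v0 permutes {..<n}" "excedances v0 = D" using basic_subset_excedances[OF D] .
  let ?w = "basic_perm n D"
  have w: "?w permutes {..<n}" "excedances ?w = D"
    using degenerates_from_basic_perm[OF v0] by auto
  have cone: "basic_cone n D = {X \<in> strictly_lower n. \<forall>F\<in>poly_functions (pos_roots n).
      (\<forall>Y\<in>basic_cell n D. F Y = 0) \<longrightarrow> F X = (0 :: 'k)}"
    unfolding basic_cone_def
    by (rule closed_strictly_lower_hull[OF basic_cell_strictly_lower[OF D]])
  show ?thesis
  proof (intro equalityI subsetI)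
    fix X :: "'k mat" assume X: "X \<in> basic_cone n D"
    then have XL: "X \<in> strictly_lower n" using cone by auto
    have "F (1\<^sub>m n + X) = 0" if F: "F \<in> poly_functions ({..<n} \<times> {..<n})"
      and F0: "\<forall>h\<in>double_coset n ?w. F h = 0" for F
    proof -
      obtain F' where F': "F' \<in> poly_functions (pos_roots n)"
        "\<And>X. X \<in> strictly_lower n \<Longrightarrow> F' X = F (1\<^sub>m n + X)"
        using poly_function_shift[OF F] by metis
      have "F' Y = 0" if Y: "Y \<in> basic_cell n D" for Y
      proof -
        have YL: "Y \<in> strictly_lower n" using basic_cell_strictly_lower[OF D] Y by auto
        obtain v where v: "v permutes {..<n}" "excedances v = D" "Y \<in> chart_cell n v"
          using basic_cell_covered_by_chart_cells[OF D Y] .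
        then have "1\<^sub>m n + Y \<in> schubert_preimage n ?w"
          using degenerates_from_basic_perm[OF v(1,2), where ?'k='k] by (auto simp: chart_cell_def)
        then show ?thesis using F F0 F'(2)[OF YL] by (simp add: schubert_preimage_def)
      qed
      then have "F' X = 0" using X F'(1) unfolding cone by blast
      then show ?thesis using F'(2)[OF XL] by simp
    qed
    then have "1\<^sub>m n + X \<in> schubert_preimage n ?w"
      using lower_unitriangular_general_linear[OF strictly_lower_add_one[OF XL]]
      by (simp add: schubert_preimage_def)
    then show "X \<in> schubert_chart n ?w" using XL by (simp add: schubert_chart_eq[OF w(1)])
  next
    fix X :: "'k mat" assume X: "X \<in> schubert_chart n ?w"
    have "F X = 0" if F: "F \<in> poly_functions (pos_roots n)" and F0: "\<forall>Y\<in>basic_cell n D. F Y = 0" for F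
    proof -
      have "pos_roots n \<subseteq> {..<n} \<times> {..<n}" by (auto simp: pos_roots_def)
      then have F': "F \<in> poly_functions ({..<n} \<times> {..<n})" using F poly_functions_mono by blast
      have "F Y = 0" if "Y \<in> chart_cell n ?w" for Y
        using F0 that chart_cell_subset_basic_cell[OF w(1)] unfolding w(2) by blast
      from chart_cell_dense[OF w(1) F' this X] show ?thesis .
    qed
    then show "X \<in> basic_cone n D" using X unfolding cone by (simp add: schubert_chart_eq[OF w(1)])
  qed
qed

section \<open>Cones and tangent cones\<close>

lemma basic_cone_iff:
  assumes D: "basic_subset n D"
  shows "basic_cone n D = {X \<in> strictly_lower n. \<forall>F\<in>poly_functions (pos_roots n).
      (\<forall>Y\<in>basic_cell n D. F Y = 0) \<longrightarrow> F X = (0 :: 'k::field)}"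
  unfolding basic_cone_def
  by (rule closed_strictly_lower_hull[OF basic_cell_strictly_lower[OF D]])

lemma strictly_lower_smult: "X \<in> strictly_lower n \<Longrightarrow> t \<cdot>\<^sub>m X \<in> strictly_lower n"
  by (auto simp: strictly_lower_def)

lemma basic_cell_smult:
  fixes X :: "'k::field mat"
  assumes D: "basic_subset n D" and X: "X \<in> basic_cell n D" and t: "t \<noteq> 0"
  shows "t \<cdot>\<^sub>m X \<in> basic_cell n D"
proof -
  obtain b c where b: "b \<in> borel_subgroup n" "c \<in> borel_subgroup n"
    "X = strictly_lower_part (b * rook_matrix n D * c)"
    using basic_cell_subset_orbit[OF D X] .
  note cr = borel_carrier[OF b(1)] borel_carrier[OF b(2)]
  have tb: "t \<cdot>\<^sub>m b \<in> borel_subgroup n" using smult_borel[OF b(1) t] .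
  have "t \<cdot>\<^sub>m b * rook_matrix n D * c = t \<cdot>\<^sub>m (b * rook_matrix n D * c)"
    using cr by (simp add: mult_smult_assoc_mat[of _ n n _ n] del: assoc_mult_mat)
  moreover have "t \<cdot>\<^sub>m X = strictly_lower_part (t \<cdot>\<^sub>m (b * rook_matrix n D * c))"
    unfolding b(3) using cr by (intro eq_matI) (auto simp: strictly_lower_part_def)
  ultimately show ?thesis using orbit_subset_basic_cell[OF D tb b(2)] by simp
qed

lemma poly_function_on_line:
  fixes F :: "'k::field mat \<Rightarrow> 'k"
  assumes F: "F \<in> poly_functions ({..<n} \<times> {..<n})" and X: "X \<in> carrier_mat n n"
  shows "(\<lambda>t. F (t \<cdot>\<^sub>m X)) \<in> range poly"
proof (rule function_algebra_compose[OF function_algebra_poly F])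
  fix v assume "v \<in> {..<n} \<times> {..<n}"
  then have "(t \<cdot>\<^sub>m X) $$ v = t * X $$ v" for t using X by auto
  moreover have "(\<lambda>t. t * X $$ v) \<in> range poly"
    by (intro function_algebra_mult function_algebra_poly poly_function_id function_algebra_const)
  ultimately show "(\<lambda>t. (t \<cdot>\<^sub>m X) $$ v) \<in> range poly" by simp
qed

lemma pos_roots_subset: "pos_roots n \<subseteq> {..<n} \<times> {..<n}"
  by (auto simp: pos_roots_def)

text \<open>
  The basic cell is stable under nonzero scalars, hence so is its closure; along the line through
  \<open>X\<close> the remaining scalar \<open>0\<close> is a limit.
\<close>

lemma basic_cone_is_cone:
  assumes D: "basic_subset n D"
  shows "is_cone n (basic_cone n D :: 'k::field_char_0 mat set)"
proof -
  have smult: "t \<cdot>\<^sub>m X \<in> basic_cone n D" if X: "X \<in> basic_cone n D" for t and X :: "'k mat"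
  proof -
    have XL: "X \<in> strictly_lower n" using X basic_cone_iff[OF D] by auto
    have "F (t \<cdot>\<^sub>m X) = 0" if F: "F \<in> poly_functions (pos_roots n)"
      and F0: "\<forall>Y\<in>basic_cell n D. F Y = 0" for F
    proof (rule poly_function_eq_0[where f="\<lambda>t. F (t \<cdot>\<^sub>m X)" and c=0])
      have F': "F \<in> poly_functions ({..<n} \<times> {..<n})"
        using F poly_functions_mono[OF pos_roots_subset] by blast
      then show "(\<lambda>t. F (t \<cdot>\<^sub>m X)) \<in> range poly"
        using XL by (intro poly_function_on_line) (auto simp: strictly_lower_def)
      fix s :: 'k assume s: "s \<noteq> 0"
      define G where "G Y = mat n n (\<lambda>(i, j). s * Y $$ (i, j))" for Y :: "'k mat"
      have G: "G Y = s \<cdot>\<^sub>m Y" if "Y \<in> strictly_lower n" for Y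
        using that by (intro eq_matI) (auto simp: G_def strictly_lower_def)
      have GP: "(\<lambda>Y. F (G Y)) \<in> poly_functions (pos_roots n)"
      proof (rule function_algebra_compose[OF function_algebra_poly_functions F])
        fix v assume v: "v \<in> pos_roots n"
        then have "(\<lambda>Y. G Y $$ v) = (\<lambda>Y. s * Y $$ v)" by (auto simp: G_def pos_roots_def)
        moreover have "(\<lambda>Y. s * Y $$ v) \<in> poly_functions (pos_roots n)"
          using v by (intro function_algebra_mult function_algebra_poly_functions
              function_algebra_const coordinate_poly_function)
        ultimately show "(\<lambda>Y. G Y $$ v) \<in> poly_functions (pos_roots n)" by simp
      qed
      have G0: "F (G Y) = 0" if Y: "Y \<in> basic_cell n D" for Y
        using F0 basic_cell_smult[OF D Y s] G basic_cell_strictly_lower[OF D] Y by fastforce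
      have "\<forall>F\<in>poly_functions (pos_roots n). (\<forall>Y\<in>basic_cell n D. F Y = 0) \<longrightarrow> F X = 0"
        using X by (simp add: basic_cone_iff[OF D])
      from bspec[OF this GP] G0 have "F (G X) = 0" by simp
      then show "F (s \<cdot>\<^sub>m X) = 0" using G[OF XL] by simp
    qed
    then show ?thesis using strictly_lower_smult[OF XL] by (simp add: basic_cone_iff[OF D])
  qed
  have "strictly_lower_part (1\<^sub>m n * rook_matrix n D * 1\<^sub>m n) \<in> (basic_cell n D :: 'k mat set)"
    by (intro orbit_subset_basic_cell D one_borel)
  then obtain X :: "'k mat" where "X \<in> basic_cell n D" by blast
  then have X: "X \<in> basic_cone n D" unfolding basic_cone_def by (rule subsetD[OF hull_subset])
  then have "X \<in> carrier_mat n n" by (simp add: basic_cone_iff[OF D] strictly_lower_def)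
  then have "0 \<cdot>\<^sub>m X = 0\<^sub>m n n" by (intro eq_matI) auto
  then show ?thesis using smult[OF X, of 0] smult by (auto simp: is_cone_def)
qed

lemma lookup_homogeneous_part:
  "Poly_Mapping.lookup (homogeneous_part d p) m =
     (if monom_degree m = d then Poly_Mapping.lookup p m else 0)"
  unfolding homogeneous_part_def
  by (auto simp: lookup_sum lookup_single when_def sum.delta' in_keys_iff)

lemma homogeneous_part_homogeneous_part:
  "homogeneous_part d (homogeneous_part e p) = (if d = e then homogeneous_part e p else 0)"
  by (intro poly_mapping_eqI) (auto simp: lookup_homogeneous_part)

lemma homogeneous_part_polys_in:
  "p \<in> polys_in V \<Longrightarrow> homogeneous_part d p \<in> polys_in V"
  by (auto simp: polys_in_def in_keys_iff lookup_homogeneous_part split: if_splits)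

lemma initial_form_homogeneous_part:
  assumes "homogeneous_part e p \<noteq> 0"
  shows "initial_form (homogeneous_part e p) = homogeneous_part e p"
proof -
  have "(LEAST d. homogeneous_part d (homogeneous_part e p) \<noteq> 0) = e"
    using assms by (intro Least_equality) (auto simp: homogeneous_part_homogeneous_part split: if_splits)
  then show ?thesis by (simp add: initial_form_def homogeneous_part_homogeneous_part)
qed

lemma poly_value_smult:
  fixes X :: "'k::field mat"
  assumes p: "p \<in> polys_in ({..<n} \<times> {..<n})" and X: "X \<in> carrier_mat n n"
  shows "poly_value p (t \<cdot>\<^sub>m X) =
    (\<Sum>d\<in>monom_degree ` Poly_Mapping.keys p. poly_value (homogeneous_part d p) X * t ^ d)"
proof -
  let ?v = "\<lambda>m. \<Prod>v\<in>Poly_Mapping.keys m. (X $$ v) ^ Poly_Mapping.lookup m v"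
  have m: "(\<Prod>v\<in>Poly_Mapping.keys m. ((t \<cdot>\<^sub>m X) $$ v) ^ Poly_Mapping.lookup m v) =
      t ^ monom_degree m * ?v m" if "m \<in> Poly_Mapping.keys p" for m
  proof -
    have "(t \<cdot>\<^sub>m X) $$ v = t * X $$ v" if "v \<in> Poly_Mapping.keys m" for v
    proof -
      have "v \<in> {..<n} \<times> {..<n}" using p \<open>m \<in> _\<close> that by (auto simp: polys_in_def)
      then show ?thesis using X by auto
    qed
    then show ?thesis
      by (simp add: power_mult_distrib prod.distrib monom_degree_def power_sum cong: prod.cong)
  qed
  have h: "poly_value (homogeneous_part d p) X =
      (\<Sum>m\<in>{m \<in> Poly_Mapping.keys p. monom_degree m = d}. Poly_Mapping.lookup p m * ?v m)" for d
    unfolding homogeneous_part_def poly_value_sum poly_value_single ..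
  have "poly_value p (t \<cdot>\<^sub>m X) =
      (\<Sum>m\<in>Poly_Mapping.keys p. Poly_Mapping.lookup p m * ?v m * t ^ monom_degree m)"
    unfolding poly_value_def by (intro sum.cong) (auto simp: m)
  also have "\<dots> = (\<Sum>d\<in>monom_degree ` Poly_Mapping.keys p.
      \<Sum>m\<in>{m \<in> Poly_Mapping.keys p. monom_degree m = d}. Poly_Mapping.lookup p m * ?v m * t ^ monom_degree m)"
    by (rule sum.image_gen) simp
  also have "\<dots> = (\<Sum>d\<in>monom_degree ` Poly_Mapping.keys p. poly_value (homogeneous_part d p) X * t ^ d)"
    unfolding h sum_distrib_right by (intro sum.cong) auto
  finally show ?thesis .
qed

text \<open>
  The homogeneous parts are the coefficients of \<open>p (t X)\<close> as a polynomial in \<open>t\<close>.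
\<close>

lemma homogeneous_part_vanishes_on_line:
  fixes X :: "'k::field_char_0 mat"
  assumes p: "p \<in> polys_in ({..<n} \<times> {..<n})" and X: "X \<in> carrier_mat n n"
    and 0: "\<And>t. poly_value p (t \<cdot>\<^sub>m X) = 0"
  shows "poly_value (homogeneous_part d p) X = 0"
proof (cases "d \<in> monom_degree ` Poly_Mapping.keys p")
  case True
  define Q where "Q = (\<Sum>d\<in>monom_degree ` Poly_Mapping.keys p.
      monom (poly_value (homogeneous_part d p) X) d)"
  have "poly Q t = 0" for t
    using 0[of t] unfolding poly_value_smult[OF p X] Q_def by (simp add: poly_sum poly_monom)
  then have "Q = 0" using poly_all_0_iff_0 by blast
  then have "coeff Q d = 0" by simp
  also have "coeff Q d = poly_value (homogeneous_part d p) X"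
    unfolding Q_def using True by (simp add: coeff_sum sum.delta')
  finally show ?thesis .
next
  case False
  then have "homogeneous_part d p = 0"
    by (intro poly_mapping_eqI) (auto simp: lookup_homogeneous_part in_keys_iff)
  then show ?thesis by simp
qed

text \<open>
  The ideal of a cone contains the homogeneous parts of its members.  So it contains all initial
  forms, and conversely it is spanned by homogeneous polynomials, each of which is its own initial
  form.  The last hypothesis says that \<open>Y\<close> is closed.
\<close>

lemma tangent_cone_of_cone:
  fixes Y :: "'k::field_char_0 mat set"
  assumes Y: "Y \<subseteq> strictly_lower n" and cone: "is_cone n Y"
    and closed: "\<And>X. X \<in> strictly_lower n \<Longrightarrow>
      (\<And>F. F \<in> poly_functions (pos_roots n) \<Longrightarrow> \<forall>Z\<in>Y. F Z = 0 \<Longrightarrow> F X = 0) \<Longrightarrow> X \<in> Y"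
  shows "tangent_cone_at_0 n Y = Y"
proof -
  have sq: "p \<in> polys_in ({..<n} \<times> {..<n})" if "p \<in> polys_in (pos_roots n)" for p :: "'k matpoly"
    using that pos_roots_subset by (auto simp: polys_in_def)
  have carr: "X \<in> carrier_mat n n" if "X \<in> strictly_lower n" for X :: "'k mat"
    using that by (simp add: strictly_lower_def)
  have hp: "homogeneous_part d p \<in> vanishing_ideal n Y" if p: "p \<in> vanishing_ideal n Y" for d p
  proof -
    have pp: "p \<in> polys_in (pos_roots n)" using p by (simp add: vanishing_ideal_def)
    have "poly_value (homogeneous_part d p) X = 0" if "X \<in> Y" for X
    proof (rule homogeneous_part_vanishes_on_line[OF sq[OF pp]])
      show "X \<in> carrier_mat n n" using that Y carr by auto
      show "poly_value p (t \<cdot>\<^sub>m X) = 0" for t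
        using p cone that by (auto simp: vanishing_ideal_def is_cone_def)
    qed
    then show ?thesis using homogeneous_part_polys_in[OF pp] by (simp add: vanishing_ideal_def)
  qed
  show ?thesis
  proof (intro equalityI subsetI)
    fix X assume X: "X \<in> tangent_cone_at_0 n Y"
    then have XL: "X \<in> strictly_lower n" by (simp add: tangent_cone_at_0_def zero_locus_def)
    show "X \<in> Y"
    proof (rule closed[OF XL])
      fix F assume F: "F \<in> poly_functions (pos_roots n)" "\<forall>Z\<in>Y. F Z = 0"
      then obtain p where p: "p \<in> polys_in (pos_roots n)" "F = poly_value p"
        by (auto simp: poly_functions_def)
      then have pI: "p \<in> vanishing_ideal n Y" using F by (simp add: vanishing_ideal_def)
      have "poly_value (homogeneous_part d p) X = 0" for d
      proof (cases "homogeneous_part d p = 0")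
        case False
        have "poly_value (initial_form (homogeneous_part d p)) X = 0"
          using X hp[OF pI] by (simp add: tangent_cone_at_0_def zero_locus_def)
        then show ?thesis by (simp only: initial_form_homogeneous_part[OF False])
      qed simp
      then have "poly_value p (1 \<cdot>\<^sub>m X) = 0"
        unfolding poly_value_smult[OF sq[OF p(1)] carr[OF XL]] by simp
      moreover have "1 \<cdot>\<^sub>m X = X" by (intro eq_matI) auto
      ultimately show "F X = 0" using p(2) by simp
    qed
  next
    fix X assume "X \<in> Y"
    then show "X \<in> tangent_cone_at_0 n Y"
      using Y hp by (auto simp: tangent_cone_at_0_def zero_locus_def initial_form_def vanishing_ideal_def)
  qed
qed

lemma schubert_chart_closed:
  assumes w: "w permutes {..<n}" and X: "X \<in> strictly_lower n"
    and 0: "\<And>F. F \<in> poly_functions (pos_roots n) \<Longrightarrow>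
      \<forall>Z\<in>schubert_chart n w. F Z = 0 \<Longrightarrow> F X = (0 :: 'k::field)"
  shows "X \<in> schubert_chart n w"
proof -
  have "F (1\<^sub>m n + X) = 0" if F: "F \<in> poly_functions ({..<n} \<times> {..<n})"
    and F0: "\<forall>h\<in>double_coset n w. F h = 0" for F
  proof -
    obtain F' where F': "F' \<in> poly_functions (pos_roots n)"
      "\<And>X. X \<in> strictly_lower n \<Longrightarrow> F' X = F (1\<^sub>m n + X)"
      using poly_function_shift[OF F] by metis
    have "F' Z = 0" if "Z \<in> schubert_chart n w" for Z
      using that F F0 F'(2) by (simp add: schubert_chart_eq[OF w] schubert_preimage_def)
    then show ?thesis using 0[OF F'(1)] F'(2)[OF X] by simp
  qed
  then show ?thesis
    using X lower_unitriangular_general_linear[OF strictly_lower_add_one[OF X]]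
    by (simp add: schubert_chart_eq[OF w] schubert_preimage_def)
qed

lemma schubert_tangent_cone_homogeneous:
  assumes "homogeneous TYPE('k::field_char_0) n w"
  shows "schubert_tangent_cone n w = (schubert_chart n w :: 'k mat set)"
proof -
  have w: "w permutes {..<n}" and c: "is_cone n (schubert_chart n w :: 'k mat set)"
    using assms by (auto simp: homogeneous_def)
  show ?thesis
    unfolding schubert_tangent_cone_def
    by (rule tangent_cone_of_cone[OF _ c schubert_chart_closed[OF w]])
      (auto simp: schubert_chart_eq[OF w])
qed

section \<open>Homogeneous permutations have no crossings\<close>

lemma det_eq_0_of_rank_bound:
  fixes M :: "'k::field mat"
  assumes M: "M \<in> carrier_mat (Suc r) (Suc r)" and S: "finite S" "card S \<le> r"
    and e: "\<And>a c. a \<le> r \<Longrightarrow> c \<le> r \<Longrightarrow> M $$ (a, c) = (\<Sum>k\<in>S. A a k * B k c)"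
  shows "det M = 0"
proof -
  obtain f where f: "bij_betw f {0..<card S} S" using ex_bij_betw_nat_finite[OF S(1)] by blast
  define A' where "A' = mat (Suc r) (Suc r) (\<lambda>(a, k). if k < card S then A a (f k) else 0)"
  define B' where "B' = mat (Suc r) (Suc r) (\<lambda>(k, c). if k < card S then B (f k) c else 0)"
  have AB: "A' \<in> carrier_mat (Suc r) (Suc r)" "B' \<in> carrier_mat (Suc r) (Suc r)"
    by (auto simp: A'_def B'_def)
  have "M = A' * B'"
  proof (rule eq_matI)
    fix a c assume "a < dim_row (A' * B')" "c < dim_col (A' * B')"
    then have ac: "a < Suc r" "c < Suc r" using AB by auto
    have "M $$ (a, c) = (\<Sum>k\<in>S. A a k * B k c)" using ac by (intro e) auto
    also have "\<dots> = (\<Sum>k\<in>{0..<card S}. A a (f k) * B (f k) c)"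
      using sum.reindex_bij_betw[OF f, of "\<lambda>k. A a k * B k c"] by simp
    also have "\<dots> = (\<Sum>k<Suc r. A' $$ (a, k) * B' $$ (k, c))"
      using S ac by (intro sum.mono_neutral_cong_left) (auto simp: A'_def B'_def)
    finally show "M $$ (a, c) = (A' * B') $$ (a, c)" unfolding mult_entry[OF AB ac] .
  qed (use M AB in auto)
  moreover have "det A' = 0"
    using S by (subst laplace_expansion_column[OF AB(1), of r]) (auto simp: A'_def intro!: sum.neutral)
  ultimately show ?thesis using det_mult[OF AB] by simp
qed

text \<open>
  Let \<open>u\<close> and \<open>X\<close> be as in the introduction.  The minor is taken in the rows \<open>\<rho>\<close> and columns \<open>\<gamma>\<close>: the
  \<open>r\<close> columns \<open>j \<le> m\<close> with \<open>v j \<ge> p\<close>, their rows \<open>v j\<close>, and in addition row and column \<open>m\<close>.  Within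
  this selection \<open>v\<close> is the identity matrix of size \<open>r\<close> bordered by zeros, since \<open>v m < p\<close> excludes
  the row of the one in column \<open>m\<close> and \<open>q > m\<close> excludes the column of the one in row \<open>m\<close>.  So the
  last row of the minor is divisible by \<open>1 - t\<close>, and what is left becomes triangular at \<open>t = 1\<close>.  On
  the other hand the minor vanishes on \<open>B w B\<close>, because at most \<open>r\<close> ones of \<open>w\<close> lie in the block of
  rows from \<open>p\<close> on and columns up to \<open>m\<close>.
\<close>

lemma not_cone_of_double_descent:
  assumes w: "w permutes {..<n}" and v: "v permutes {..<n}"
    and vw: "double_coset n v \<subseteq> (schubert_preimage n w :: 'k::field_char_0 mat set)"
    and m: "m < n" "p \<le> m" "v m < p" and q: "v q = m" "m < q"
    and card: "card {j. j \<le> m \<and> p \<le> w j} \<le> card {j. j \<le> m \<and> p \<le> v j}"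
  shows "\<not> is_cone n (schubert_chart n w :: 'k mat set)"
proof
  assume cone: "is_cone n (schubert_chart n w :: 'k mat set)"
  let ?V = "{..<n} \<times> {..<n}"
  have inj: "v x = v y \<longleftrightarrow> x = y" for x y using permutes_inj[OF v] by (auto dest: injD)
  have vn: "v j < n" if "j < n" for j using permutes_in_image[OF v, of j] that by auto
  have wn: "w j < n" if "j < n" for j using permutes_in_image[OF w, of j] that by auto
  let ?J = "{j. j \<le> m \<and> p \<le> v j}"
  define r where "r = card ?J"
  have "finite ?J" by (rule finite_subset[of _ "{..m}"]) auto
  then obtain f where f: "bij_betw f {0..<r} ?J" using ex_bij_betw_nat_finite r_def by blast
  have fJ: "f a \<le> m" "p \<le> v (f a)" if "a < r" for a
    using bij_betwE[OF f] that by auto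
  have f_inj: "f a = f c \<longleftrightarrow> a = c" if "a < r" "c < r" for a c
    using bij_betw_imp_inj_on[OF f] that by (auto simp: inj_on_def)
  define \<gamma> where "\<gamma> a = (if a < r then f a else m)" for a
  define \<rho> where "\<rho> a = (if a < r then v (f a) else m)" for a
  have \<gamma>: "\<gamma> a \<le> m" "\<gamma> a < n" and \<rho>: "p \<le> \<rho> a" "\<rho> a < n" for a
    using fJ[of a] m vn[of "f a"] by (auto simp: \<gamma>_def \<rho>_def)
  obtain X :: "'k mat" where "X \<in> chart_cell n v" using chart_cell_nonempty[OF v] by blast
  then obtain b b' where XL: "X \<in> strictly_lower n" and X: "1\<^sub>m n + X \<in> double_coset n v"
    and b: "b \<in> borel_subgroup n" "b' \<in> borel_subgroup n" "1\<^sub>m n + X = b * perm_matrix n v * b'"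
    by (auto simp: chart_cell_def double_coset_def)
  obtain c where c: "c \<in> borel_subgroup n" "c * b = 1\<^sub>m n" using borel_inverse[OF b(1)] by metis
  obtain c' where c': "c' \<in> borel_subgroup n" "b' * c' = 1\<^sub>m n" using borel_inverse[OF b(2)] by metis
  note cr = borel_carrier[OF c(1)] borel_carrier[OF c'(1)] borel_carrier[OF b(1)]
    borel_carrier[OF b(2)]
  have Xc: "X \<in> carrier_mat n n" using XL by (simp add: strictly_lower_def)
  let ?u = "c * c'"
  have u: "?u \<in> borel_subgroup n" using borel_mult[OF c(1) c'(1)] .
  have "c * (b * perm_matrix n v * b') * c' = (c * b) * perm_matrix n v * (b' * c')"
    using cr by (simp add: square_mult_assoc[of _ n])
  then have cXc: "c * (1\<^sub>m n + X) * c' = perm_matrix n v" using c c' by (simp add: b(3))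
  \<comment> \<open>The submatrix in rows \<open>\<rho>\<close> and columns \<open>\<gamma>\<close>; \<open>F\<close> below is its determinant, pulled back along
    \<open>Z \<mapsto> b\<inverse> Z c\<inverse>\<close> for \<open>1 + X = b v c\<close>.  In the proof \<open>b'\<close> stands for this last \<open>c\<close>, and \<open>c, c'\<close>
    for the inverses of \<open>b, b'\<close>.\<close>
  define N where "N Z = mat (Suc r) (Suc r) (\<lambda>(a, e). Z $$ (\<rho> a, \<gamma> e))" for Z :: "'k mat"
  have NP: "(\<lambda>Z. det (N Z)) \<in> poly_functions ?V"
  proof (rule function_algebra_det[OF function_algebra_poly_functions])
    show "N Z \<in> carrier_mat (Suc r) (Suc r)" for Z by (simp add: N_def)
    show "(\<lambda>Z. N Z $$ (a, e)) \<in> poly_functions ?V" if "a < Suc r" "e < Suc r" for a e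
      using that \<rho> \<gamma> coordinate_poly_function[of "(\<rho> a, \<gamma> e)" ?V] by (simp add: N_def)
  qed
  obtain F where F: "F \<in> poly_functions ?V"
    "\<And>Z. Z \<in> carrier_mat n n \<Longrightarrow> F Z = det (N (c * Z * c'))"
    using poly_function_sandwich[OF NP cr(1,2)] by metis
  have F0: "F h = 0" if h: "h \<in> double_coset n w" for h
  proof -
    have hc: "h \<in> carrier_mat n n"
      using h double_coset_general_linear[OF w] general_linear_carrier by blast
    have "c * h * c' \<in> double_coset n w"
      by (intro double_coset_mult h c c')
    then obtain d d' where d: "d \<in> borel_subgroup n" "d' \<in> borel_subgroup n"
      "c * h * c' = d * perm_matrix n w * d'"
      by (auto simp: double_coset_def)
    let ?S = "{j. j \<le> m \<and> p \<le> w j}"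
    have "det (N (c * h * c')) = 0"
    proof (rule det_eq_0_of_rank_bound[where S="?S" and r=r])
      show "finite ?S" by (rule finite_subset[of _ "{..m}"]) auto
      show "card ?S \<le> r" using card r_def by simp
      show "N (c * h * c') \<in> carrier_mat (Suc r) (Suc r)" by (simp add: N_def)
      fix a e assume ae: "a \<le> r" "e \<le> r"
      have dw: "d * perm_matrix n w \<in> carrier_mat n n" using d by simp
      have "N (c * h * c') $$ (a, e) = (d * perm_matrix n w * d') $$ (\<rho> a, \<gamma> e)"
        using ae d(3) by (simp add: N_def)
      also have "\<dots> = (\<Sum>k<n. (d * perm_matrix n w) $$ (\<rho> a, k) * d' $$ (k, \<gamma> e))"
        by (rule mult_entry[OF dw borel_carrier[OF d(2)] \<rho>(2) \<gamma>(2)])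
      also have "\<dots> = (\<Sum>k<n. d $$ (\<rho> a, w k) * d' $$ (k, \<gamma> e))"
        by (intro sum.cong refl, subst mult_perm_matrix_entry[OF borel_carrier[OF d(1)] w \<rho>(2)]) auto
      also have "\<dots> = (\<Sum>k\<in>?S. d $$ (\<rho> a, w k) * d' $$ (k, \<gamma> e))"
      proof (rule sum.mono_neutral_right)
        show "?S \<subseteq> {..<n}" using m by auto
        show "\<forall>k\<in>{..<n} - ?S. d $$ (\<rho> a, w k) * d' $$ (k, \<gamma> e) = 0"
        proof
          fix k assume k: "k \<in> {..<n} - ?S"
          show "d $$ (\<rho> a, w k) * d' $$ (k, \<gamma> e) = 0"
          proof (cases "k \<le> m")
            case True
            then have "w k < \<rho> a" using k \<rho>(1)[of a] by auto
            then have "d $$ (\<rho> a, w k) = 0"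
              using borel_upper_triangular[OF d(1)] borel_carrier[OF d(1)] \<rho>(2)[of a]
              by (auto simp: upper_triangular_def)
            then show ?thesis by simp
          next
            case False
            then have "\<gamma> e < k" using \<gamma>(1)[of e] by simp
            then have "d' $$ (k, \<gamma> e) = 0"
              using borel_upper_triangular[OF d(2)] borel_carrier[OF d(2)] k
              by (auto simp: upper_triangular_def)
            then show ?thesis by simp
          qed
        qed
      qed simp
      finally show "N (c * h * c') $$ (a, e) = (\<Sum>k\<in>?S. d $$ (\<rho> a, w k) * d' $$ (k, \<gamma> e))" .
    qed
    then show ?thesis using F(2)[OF hc] by simp
  qed
  have "X \<in> schubert_chart n w"
    using XL X vw by (auto simp: schubert_chart_eq[OF w])
  then have tX: "t \<cdot>\<^sub>m X \<in> schubert_chart n w" for t using cone by (auto simp: is_cone_def)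
  have N0: "det (N (c * (1\<^sub>m n + t \<cdot>\<^sub>m X) * c')) = 0" for t
  proof -
    have "1\<^sub>m n + t \<cdot>\<^sub>m X \<in> schubert_preimage n w" using tX[of t] by (simp add: schubert_chart_eq[OF w])
    then have "F (1\<^sub>m n + t \<cdot>\<^sub>m X) = 0" using F(1) F0 by (simp add: schubert_preimage_def)
    then show ?thesis using F(2)[of "1\<^sub>m n + t \<cdot>\<^sub>m X"] Xc by simp
  qed
  have entry: "(c * (1\<^sub>m n + t \<cdot>\<^sub>m X) * c') $$ (i, j) = (1 - t) * ?u $$ (i, j) + t * perm_matrix n v $$ (i, j)"
    if ij: "i < n" "j < n" for t i j
  proof -
    have "1\<^sub>m n + t \<cdot>\<^sub>m X = (1 - t) \<cdot>\<^sub>m 1\<^sub>m n + t \<cdot>\<^sub>m (1\<^sub>m n + X)"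
      using Xc by (intro eq_matI) (auto simp: algebra_simps)
    then have "c * (1\<^sub>m n + t \<cdot>\<^sub>m X) * c' = c * ((1 - t) \<cdot>\<^sub>m 1\<^sub>m n + t \<cdot>\<^sub>m (1\<^sub>m n + X)) * c'" by simp
    also have "\<dots> = (1 - t) \<cdot>\<^sub>m (c * 1\<^sub>m n * c') + t \<cdot>\<^sub>m (c * (1\<^sub>m n + X) * c')"
      using cr Xc
      by (simp add: mult_add_distrib_mat[of _ n n _ n] add_mult_distrib_mat[of _ n n _ _ n]
          mult_smult_assoc_mat[of _ n n _ n] mult_smult_distrib[of _ n n _ n] del: assoc_mult_mat)
    also have "\<dots> = (1 - t) \<cdot>\<^sub>m ?u + t \<cdot>\<^sub>m perm_matrix n v" using cXc cr by simp
    finally show ?thesis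
      using ij cr carrier_matD[OF perm_matrix_carrier[of n v, where ?'a='k]]
      by (simp del: index_mult_mat(1))
  qed
  \<comment> \<open>The submatrix at \<open>1 + t X\<close> after division of its last row by \<open>1 - t\<close>.\<close>
  define N' where "N' t = mat (Suc r) (Suc r) (\<lambda>(a, e). if a < r
    then (1 - t) * ?u $$ (\<rho> a, \<gamma> e) + (if a = e then t else 0) else ?u $$ (m, \<gamma> e))" for t
  have N'c: "N' t \<in> carrier_mat (Suc r) (Suc r)" for t by (simp add: N'_def)
  have NN': "N (c * (1\<^sub>m n + t \<cdot>\<^sub>m X) * c') = multrow r (1 - t) (N' t)" for t
  proof (rule eq_matI)
    fix a e assume "a < dim_row (multrow r (1 - t) (N' t))" "e < dim_col (multrow r (1 - t) (N' t))"
    then have ae: "a \<le> r" "e \<le> r" by (auto simp: N'_def)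
    have "(perm_matrix n v :: 'k mat) $$ (\<rho> a, \<gamma> e) = (if a < r \<and> a = e then 1 else 0)"
    proof (cases "a < r")
      case True
      have "m \<noteq> f a" using fJ[OF True] m by auto
      then show ?thesis
        using True \<rho>(2)[of a] \<gamma>(2)[of e] f_inj[OF True, of e]
        by (auto simp: perm_matrix_def \<rho>_def \<gamma>_def inj)
    next
      case False
      have "\<gamma> e \<noteq> q" using \<gamma>(1)[of e] q by simp
      then have "m \<noteq> v (\<gamma> e)" using q inj by metis
      then show ?thesis using False m \<gamma>(2)[of e] by (simp add: perm_matrix_def \<rho>_def)
    qed
    then have "N (c * (1\<^sub>m n + t \<cdot>\<^sub>m X) * c') $$ (a, e) =
        (1 - t) * ?u $$ (\<rho> a, \<gamma> e) + t * (if a < r \<and> a = e then 1 else 0)"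
      using ae entry[OF \<rho>(2)[of a] \<gamma>(2)[of e], of t]
      by (simp add: N_def del: index_mult_mat(1) assoc_mult_mat)
    also have "\<dots> = multrow r (1 - t) (N' t) $$ (a, e)"
    proof (cases "a < r")
      case True
      then show ?thesis using ae by (simp add: N'_def del: index_mult_mat(1))
    next
      case False
      then have "a = r" using ae by simp
      then show ?thesis using ae by (simp add: N'_def \<rho>_def del: index_mult_mat(1))
    qed
    finally show "N (c * (1\<^sub>m n + t \<cdot>\<^sub>m X) * c') $$ (a, e) = multrow r (1 - t) (N' t) $$ (a, e)" .
  qed (auto simp: N_def N'_def)
  have "det (N' t) = 0" if "t \<noteq> 1" for t
    using N0[of t] that unfolding NN' by (simp add: det_multrow[OF _ N'c])
  moreover have "(\<lambda>t. det (N' t)) \<in> range poly"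
  proof (rule function_algebra_det[OF function_algebra_poly N'c])
    fix a e assume ae: "a < Suc r" "e < Suc r"
    have const: "(\<lambda>_. x) \<in> range (poly :: 'k poly \<Rightarrow> _)" for x
      by (rule function_algebra_const[OF function_algebra_poly])
    have "(\<lambda>t. (1 + (- 1) * t) * ?u $$ (\<rho> a, \<gamma> e) + (if a = e then 1 else 0) * t) \<in> range poly"
      by (intro function_algebra_add function_algebra_mult function_algebra_poly const poly_function_id)
    moreover have "(\<lambda>t. N' t $$ (a, e)) = (if a < r
        then (\<lambda>t. (1 + (- 1) * t) * ?u $$ (\<rho> a, \<gamma> e) + (if a = e then 1 else 0) * t)
        else (\<lambda>t. ?u $$ (m, \<gamma> e)))"
      using ae by (auto simp: N'_def simp del: index_mult_mat(1))
    ultimately show "(\<lambda>t. N' t $$ (a, e)) \<in> range poly" using const by simp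
  qed
  ultimately have "det (N' 1) = 0" by (intro poly_function_eq_0[of "\<lambda>t. det (N' t)" 1 1])
  moreover have "det (N' 1) = prod_list (diag_mat (N' 1))"
    by (rule det_lower_triangular[OF _ N'c]) (auto simp: N'_def)
  moreover have "0 \<notin> set (diag_mat (N' 1))"
  proof -
    have "?u $$ (m, m) \<noteq> 0" using u m unfolding borel_iff by auto
    then show ?thesis
      by (auto simp: diag_mat_def N'_def \<gamma>_def less_Suc_eq simp del: index_mult_mat(1))
  qed
  ultimately show False by (simp add: prod_list_zero_iff)
qed

text \<open>
  If \<open>w\<close> has a place \<open>m\<close> with \<open>w m < m < w\<inverse> m\<close>, the previous lemma applies to \<open>v = w\<close> and \<open>p = m\<close>.
  Otherwise a crossing \<open>k < l\<close> has \<open>w l < k\<close>, and the row \<open>k\<close> is used by some \<open>k' < k\<close>.  Exchanging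
  the values at \<open>k'\<close> and \<open>l\<close> moves down in the Bruhat order and produces such a place \<open>m = k\<close>, because
  \<open>l > k\<close> now takes the value \<open>k\<close>.  For \<open>p = w l\<close> the block is not affected: \<open>k'\<close> only changes its
  value from \<open>k\<close> to \<open>w l\<close>, and both are at least \<open>p\<close>.
\<close>

lemma homogeneous_noncrossing:
  assumes w: "w permutes {..<n}" and cone: "is_cone n (schubert_chart n w :: 'k::field_char_0 mat set)"
    and l: "l < n"
  shows "\<not> crossing w k l"
proof
  assume "crossing w k l"
  then have kl: "k < l" "w k < w l" "w l \<le> k" by (auto simp: crossing_def)
  have no_descent: "\<not> (w m < m \<and> w q = m \<and> m < q)" if "m < n" for m q
    using not_cone_of_double_descent[OF w w double_coset_subset_preimage[OF w] that order_refl, of q] cone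
    by auto
  obtain k' where k': "w k' = k" using permutes_surj[OF w] by (metis surjD)
  have "k' \<noteq> k" using k' kl by auto
  moreover have "\<not> k < k'" using no_descent[of k k'] k' kl l by auto
  ultimately have "k' < k" by simp
  have "w l \<noteq> k" using no_descent[of k l] kl l by auto
  let ?v = "w \<circ> Transposition.transpose k' l"
  have tr: "Transposition.transpose k' l permutes {..<n}"
    using \<open>k' < k\<close> kl l by (intro permutes_swap_id) auto
  have v: "?v permutes {..<n}" using tr w by (rule permutes_compose)
  have vv: "?v \<circ> Transposition.transpose k' l = w" by (simp add: comp_assoc)
  have v_at: "?v k' = w l" "?v l = k" "?v k = w k"
    using \<open>k' < k\<close> kl k' by auto
  have "?v k' < ?v l" unfolding v_at using \<open>w l \<noteq> k\<close> kl by simp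
  moreover have "k' < l" using \<open>k' < k\<close> kl by simp
  ultimately have "double_coset n ?v \<subseteq>
      (schubert_preimage n (?v \<circ> Transposition.transpose k' l) :: 'k mat set)"
    using l by (intro transpose_degeneration[OF v])
  then have vw: "double_coset n ?v \<subseteq> (schubert_preimage n w :: 'k mat set)" unfolding vv .
  have "{j. j \<le> k \<and> w l \<le> ?v j} = {j. j \<le> k \<and> w l \<le> w j}"
  proof (intro Collect_cong conj_cong refl)
    fix j assume "j \<le> k"
    then show "w l \<le> ?v j \<longleftrightarrow> w l \<le> w j"
      using kl k' by (cases "j = k'") auto
  qed
  then have "\<not> is_cone n (schubert_chart n w :: 'k mat set)"
    using kl l v_at by (intro not_cone_of_double_descent[OF w v vw, of k "w l" l]) auto
  then show False using cone by simp
qed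

section \<open>Basic cones as tangent cones\<close>

theorem corollary1p3:
  fixes n :: nat
  assumes "n \<ge> 1"
  shows
    "(\<forall>D. basic_subset n D \<longrightarrow>
        homogeneous TYPE('k::field_char_0) n (basic_perm n D) \<and>
        (basic_cone n D :: 'k mat set) = schubert_chart n (basic_perm n D)) \<and>
     {basic_cone n D :: 'k mat set | D. basic_subset n D} =
       {schubert_tangent_cone n w :: 'k mat set | w. homogeneous TYPE('k) n w}"
proof -
  have 1: "homogeneous TYPE('k) n (basic_perm n D) \<and>
      (basic_cone n D :: 'k mat set) = schubert_chart n (basic_perm n D)" if D: "basic_subset n D" for D
  proof -
    obtain v where "v permutes {..<n}" "excedances v = D" using basic_subset_excedances[OF D] .
    then have "basic_perm n D permutes {..<n}" using degenerates_from_basic_perm by blast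
    then show ?thesis
      using basic_cone_eq_schubert_chart[OF D, where ?'k='k] basic_cone_is_cone[OF D, where ?'k='k]
      by (simp add: homogeneous_def)
  qed
  have 2: "\<exists>D. basic_subset n D \<and> schubert_tangent_cone n w = (basic_cone n D :: 'k mat set)"
    if hw: "homogeneous TYPE('k) n w" for w
  proof -
    have w: "w permutes {..<n}" "is_cone n (schubert_chart n w :: 'k mat set)"
      using hw by (auto simp: homogeneous_def)
    have "w = basic_perm n (excedances w)"
      by (rule noncrossing_eq_basic_perm[OF w(1) homogeneous_noncrossing[OF w]])
    then have "(schubert_chart n w :: 'k mat set) = basic_cone n (excedances w)"
      using 1[OF excedances_basic[OF w(1)]] by simp
    then show ?thesis
      using schubert_tangent_cone_homogeneous[OF hw] excedances_basic[OF w(1)] by auto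
  qed
  have 3: "\<exists>w. (basic_cone n D :: 'k mat set) = schubert_tangent_cone n w \<and> homogeneous TYPE('k) n w"
    if D: "basic_subset n D" for D
    using 1[OF D] schubert_tangent_cone_homogeneous[of n "basic_perm n D", where ?'k='k] by metis
  have "{basic_cone n D :: 'k mat set | D. basic_subset n D} =
      {schubert_tangent_cone n w :: 'k mat set | w. homogeneous TYPE('k) n w}"
  proof (intro equalityI subsetI)
    fix Y assume "Y \<in> {basic_cone n D :: 'k mat set | D. basic_subset n D}"
    then obtain D where "basic_subset n D" "Y = basic_cone n D" by auto
    then show "Y \<in> {schubert_tangent_cone n w :: 'k mat set | w. homogeneous TYPE('k) n w}"
      using 3[of D] by auto
  next
    fix Y assume "Y \<in> {schubert_tangent_cone n w :: 'k mat set | w. homogeneous TYPE('k) n w}"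
    then obtain w where w: "homogeneous TYPE('k) n w" "Y = schubert_tangent_cone n w" by auto
    obtain D where D: "basic_subset n D" "schubert_tangent_cone n w = (basic_cone n D :: 'k mat set)"
      using 2[OF w(1)] by auto
    show "Y \<in> {basic_cone n D :: 'k mat set | D. basic_subset n D}"
      unfolding w(2) D(2) using D(1) by (intro CollectI exI[of _ D] conjI refl)
  qed
  with 1 show ?thesis by simp
qed

end
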